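(* Let $m\ge 38$ and let $G$ be a finite simple graph with exactly $m$ edges and without isolated vertices. If $$\lambda(G)\ge 1+\sqrt{m-2},$$ then $G$ contains a cycle $C_i$ of length $i$ (as a not necessarily induced subgraph) for every $3\le i\le 7$, unless $G\cong K_3\nabla\left(\frac{m-3}{3}K_1\right)$.
   Context: All graphs are finite and simple. $\lambda(G)$ denotes the spectral radius of $G$, i.e. the largest modulus of an eigenvalue of the adjacency matrix of $G$. $G\nabla H$ denotes the join of $G$ and $H$ (disjoint union plus all edges between $V(G)$ and $V(H)$), and $tK_1$ is the edgeless graph on $t$ vertices. The graph $K_3\nabla\frac{m-3}{3}K_1$ is defined only when $3$ divides $m$; when $3\nmid m$, no graph is isomorphic to it. *)

theory Defs
  imports
    "Graph_Theory.Pair_Digraph"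
    "Graph_Theory.Digraph_Isomorphism"
    "Jordan_Normal_Form.Spectral_Radius"
begin

text \<open>
  Finite simple graphs are rendered by the locale \<^locale>\<open>pair_graph\<close>: a finite vertex set with
  a symmetric, irreflexive set of ordered pairs. An edge is thus represented by two opposite arcs,
  and edges are counted as unordered pairs.
\<close>

definition edges :: "'a pair_pre_digraph \<Rightarrow> 'a set set" where
  "edges G = (\<lambda>(u, v). {u, v}) ` parcs G"

definition isolated :: "'a pair_pre_digraph \<Rightarrow> 'a \<Rightarrow> bool" where
  "isolated G u \<longleftrightarrow> u \<in> pverts G \<and> (\<forall>v. (u, v) \<notin> parcs G)"

definition adjacency_mat :: "'a list \<Rightarrow> 'a pair_pre_digraph \<Rightarrow> complex mat" where
  "adjacency_mat vs G =
     mat (length vs) (length vs) (\<lambda>(i, j). if (vs ! i, vs ! j) \<in> parcs G then 1 else 0)"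

text \<open>
  The choice of the enumeration of the vertices is immaterial: see \<open>graph_spectral_radius_eq\<close>
  below. For the graph without vertices the value is unspecified.
\<close>

definition graph_spectral_radius :: "'a pair_pre_digraph \<Rightarrow> real" where
  "graph_spectral_radius G =
     spectral_radius (adjacency_mat (SOME vs. distinct vs \<and> set vs = pverts G) G)"

text \<open>
  In a symmetric digraph, \<^const>\<open>pre_digraph.cycle\<close> also admits \<open>u, v, u\<close>, so the following is
  the graph-theoretic notion only for \<open>k \<ge> 3\<close>.
\<close>

definition contains_cycle :: "'a pair_pre_digraph \<Rightarrow> nat \<Rightarrow> bool" where
  "contains_cycle G k \<longleftrightarrow> (\<exists>p. pre_digraph.cycle (with_proj G) p \<and> length p = k)"

definition complete_graph :: "nat \<Rightarrow> nat pair_pre_digraph" where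
  "complete_graph n = \<lparr>pverts = {..<n}, parcs = {(u, v). u < n \<and> v < n \<and> u \<noteq> v}\<rparr>"

definition edgeless_graph :: "nat \<Rightarrow> nat pair_pre_digraph" where
  "edgeless_graph n = \<lparr>pverts = {..<n}, parcs = {}\<rparr>"

definition graph_join ::
    "'a pair_pre_digraph \<Rightarrow> 'b pair_pre_digraph \<Rightarrow> ('a + 'b) pair_pre_digraph" where
  "graph_join G H = \<lparr>
     pverts = pverts G <+> pverts H,
     parcs = map_prod Inl Inl ` parcs G \<union> map_prod Inr Inr ` parcs H
       \<union> (Inl ` pverts G) \<times> (Inr ` pverts H) \<union> (Inr ` pverts H) \<times> (Inl ` pverts G)\<rparr>"

definition graph_iso :: "'a pair_pre_digraph \<Rightarrow> 'b pair_pre_digraph \<Rightarrow> bool" where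
  "graph_iso G H \<longleftrightarrow> digraph_iso (with_proj G) (with_proj H)"

lemma graph_iso_iff:
  assumes "pair_graph G"
  shows "graph_iso G H \<longleftrightarrow>
    (\<exists>f. inj_on f (pverts G) \<and> pverts H = f ` pverts G \<and> parcs H = map_prod f f ` parcs G)"
proof
  interpret pair_graph G by fact
  assume "graph_iso G H"
  then obtain h where h: "pre_digraph.digraph_isomorphism (with_proj G) h"
    and H: "with_proj H = app_iso h (with_proj G)"
    by (auto simp: graph_iso_def digraph_iso_def)
  have eqs: "pverts H = iso_verts h ` pverts G" "parcs H = iso_arcs h ` parcs G"
    "fst = iso_tail h" "snd = iso_head h"
    using arg_cong[OF H, of verts] arg_cong[OF H, of arcs]
      arg_cong[OF H, of tail] arg_cong[OF H, of head] by simp_all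
  have inj: "inj_on (iso_verts h) (pverts G)"
    and *: "\<And>a. a \<in> parcs G \<Longrightarrow> iso_verts h (fst a) = fst (iso_arcs h a)"
      "\<And>a. a \<in> parcs G \<Longrightarrow> iso_verts h (snd a) = snd (iso_arcs h a)"
    using h unfolding pre_digraph.digraph_isomorphism_def eqs(3,4)[symmetric] by auto
  have "iso_arcs h a = map_prod (iso_verts h) (iso_verts h) a" if "a \<in> parcs G" for a
    using *[OF that] by (cases a) (auto intro: prod_eqI)
  then have "parcs H = map_prod (iso_verts h) (iso_verts h) ` parcs G"
    unfolding eqs(2) by (rule image_cong[OF refl])
  with inj eqs(1) show "\<exists>f. inj_on f (pverts G) \<and> pverts H = f ` pverts G
      \<and> parcs H = map_prod f f ` parcs G" by blast
next
  interpret pair_graph G by fact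
  assume "\<exists>f. inj_on f (pverts G) \<and> pverts H = f ` pverts G \<and> parcs H = map_prod f f ` parcs G"
  then obtain f where f: "inj_on f (pverts G)" "pverts H = f ` pverts G"
    "parcs H = map_prod f f ` parcs G" by blast
  let ?h = "\<lparr>iso_verts = f, iso_arcs = map_prod f f, iso_head = snd, iso_tail = fst\<rparr>"
  have "parcs G \<subseteq> pverts G \<times> pverts G" using wellformed' by auto
  then have "inj_on (map_prod f f) (parcs G)"
    using map_prod_inj_on[OF f(1) f(1)] inj_on_subset by blast
  then have "digraph_isomorphism ?h"
    using f(1) wf_digraph by (auto simp: digraph_isomorphism_def)
  moreover have "with_proj H = app_iso ?h (with_proj G)"
    using f(2,3) by (simp add: with_proj_def app_iso_def)
  ultimately show "graph_iso G H" unfolding graph_iso_def digraph_iso_def by blast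
qed

lemma pair_graph_graph_join:
  assumes "pair_graph G" "pair_graph H"
  shows "pair_graph (graph_join G H)"
proof -
  interpret G: pair_graph G by fact
  interpret H: pair_graph H by fact
  show ?thesis
  proof unfold_locales
    fix e assume "e \<in> parcs (graph_join G H)"
    then show "fst e \<in> pverts (graph_join G H)" "snd e \<in> pverts (graph_join G H)"
      "fst e \<noteq> snd e"
      using G.wellformed' H.wellformed' G.no_loops' H.no_loops'
      by (auto simp: graph_join_def)
  next
    show "finite (pverts (graph_join G H))" "finite (parcs (graph_join G H))"
      by (simp_all add: graph_join_def)
  next
    have "(y, x) \<in> parcs (graph_join G H)" if "(x, y) \<in> parcs (graph_join G H)" for x y
      using that G.arcs_symmetric H.arcs_symmetric
      by (cases x; cases y) (auto simp: graph_join_def map_prod_def image_iff Bex_def split: prod.splits)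
    then show "symmetric (with_proj (graph_join G H))"
      by (auto simp: symmetric_def intro: symI)
  qed
qed

lemma pair_graph_complete_graph: "pair_graph (complete_graph n)"
proof -
  have "finite {(u, v). u < n \<and> v < n \<and> u \<noteq> v}"
    by (rule finite_subset[of _ "{..<n} \<times> {..<n}"]) auto
  then show ?thesis
    by unfold_locales (auto simp: complete_graph_def symmetric_def intro!: symI)
qed

lemma pair_graph_edgeless_graph: "pair_graph (edgeless_graph n)"
  by unfold_locales (auto simp: edgeless_graph_def symmetric_def intro!: symI)

lemma eigenvalue_adjacency_mat_iff:
  assumes "distinct vs"
  shows "eigenvalue (adjacency_mat vs G) k \<longleftrightarrow>
    (\<exists>f. (\<exists>v\<in>set vs. f v \<noteq> 0) \<and>
       (\<forall>v\<in>set vs. (\<Sum>u | u \<in> set vs \<and> (v, u) \<in> parcs G. f u) = k * f v))"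
    (is "?L \<longleftrightarrow> ?R")
proof -
  let ?n = "length vs"
  let ?A = "adjacency_mat vs G"
  have bij: "bij_betw (\<lambda>i. vs ! i) {0..<?n} (set vs)"
    using assms bij_betw_nth by (metis atLeast0LessThan)
  have row: "(?A *\<^sub>v x) $ i = (\<Sum>u | u \<in> set vs \<and> (vs ! i, u) \<in> parcs G. f u)"
    if "dim_vec x = ?n" "i < ?n" "\<And>j. j < ?n \<Longrightarrow> x $ j = f (vs ! j)" for x i f
  proof -
    have "(?A *\<^sub>v x) $ i = (\<Sum>j\<in>{0..<?n}. if (vs ! i, vs ! j) \<in> parcs G then f (vs ! j) else 0)"
      using that by (auto simp: adjacency_mat_def scalar_prod_def intro!: sum.cong)
    also have "\<dots> = (\<Sum>u\<in>set vs. if (vs ! i, u) \<in> parcs G then f u else 0)"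
      by (rule sum.reindex_bij_betw[OF bij])
    also have "\<dots> = (\<Sum>u | u \<in> set vs \<and> (vs ! i, u) \<in> parcs G. f u)"
      by (simp add: sum.inter_filter)
    finally show ?thesis .
  qed
  have dim [simp]: "dim_row ?A = ?n" by (simp add: adjacency_mat_def)
  show ?thesis
  proof
    assume ?L
    then obtain x where x: "x \<in> carrier_vec ?n" "x \<noteq> 0\<^sub>v ?n" "?A *\<^sub>v x = k \<cdot>\<^sub>v x"
      by (auto simp: eigenvalue_def eigenvector_def)
    define f where "f v = x $ (the_inv_into {0..<?n} (\<lambda>i. vs ! i) v)" for v
    have f: "x $ j = f (vs ! j)" if "j < ?n" for j
      using that bij by (simp add: f_def the_inv_into_f_f bij_betw_def)
    from x(1,2) obtain j where "j < ?n" "x $ j \<noteq> 0"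
      by (metis carrier_vecD dim_vec_first eq_vecI index_zero_vec(1) index_zero_vec(2))
    then have "\<exists>v\<in>set vs. f v \<noteq> 0" using f by (metis nth_mem)
    moreover have "(\<Sum>u | u \<in> set vs \<and> (v, u) \<in> parcs G. f u) = k * f v" if v: "v \<in> set vs" for v
    proof -
      from v obtain i where i: "i < ?n" "v = vs ! i" by (metis in_set_conv_nth)
      have "(?A *\<^sub>v x) $ i = k * x $ i" using x i by simp
      then show ?thesis using row[of x i f] x(1) f i by auto
    qed
    ultimately show ?R by blast
  next
    assume ?R
    then obtain f where f: "\<exists>v\<in>set vs. f v \<noteq> 0"
      "\<And>v. v \<in> set vs \<Longrightarrow> (\<Sum>u | u \<in> set vs \<and> (v, u) \<in> parcs G. f u) = k * f v" by blast
    let ?x = "vec ?n (\<lambda>i. f (vs ! i))"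
    from f(1) obtain i where i: "i < ?n" "f (vs ! i) \<noteq> 0" by (metis in_set_conv_nth)
    then have "?x $ i \<noteq> 0\<^sub>v ?n $ i" by simp
    then have "?x \<noteq> 0\<^sub>v ?n" by metis
    moreover have "?A *\<^sub>v ?x = k \<cdot>\<^sub>v ?x"
      using row[of ?x _ f] f(2) by (intro eq_vecI) auto
    ultimately show ?L unfolding eigenvalue_def eigenvector_def
      by (intro exI[of _ ?x]) simp
  qed
qed

lemma graph_spectral_radius_eq:
  assumes "distinct vs" "set vs = pverts G"
  shows "graph_spectral_radius G = spectral_radius (adjacency_mat vs G)"
proof -
  define ws where "ws = (SOME vs. distinct vs \<and> set vs = pverts G)"
  have ws: "distinct ws" "set ws = pverts G"
    using someI[of "\<lambda>vs. distinct vs \<and> set vs = pverts G" vs] assms by (simp_all add: ws_def)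
  have "spectrum (adjacency_mat ws G) = spectrum (adjacency_mat vs G)"
    unfolding spectrum_def eigenvalue_adjacency_mat_iff[OF ws(1)]
      eigenvalue_adjacency_mat_iff[OF assms(1)] set_eq_iff mem_Collect_eq ws(2) assms(2)
    by simp
  then show ?thesis
    by (simp add: graph_spectral_radius_def spectral_radius_def ws_def)
qed

end

theory Submission
  imports Defs
begin

text \<open>
  Let \<open>\<lambda>\<close> be the spectral radius of \<open>G\<close>. The assumption says \<open>\<lambda>\<^sup>2 - 2\<lambda> \<ge> m - 3\<close>, and \<open>m \<ge> 38\<close> makes
  \<open>\<lambda> \<ge> 7\<close>. Take an eigenvector for an eigenvalue of modulus \<open>\<lambda>\<close> and let \<open>x\<close> consist of the moduli of its
  entries, scaled to have maximum 1, attained at \<open>u\<close>. Then \<open>\<lambda>x \<le> Ax\<close>. Let \<open>N\<close> be the neighbourhood of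
  \<open>u\<close> and \<open>W\<close> the set of vertices other than \<open>u\<close> not adjacent to \<open>u\<close>. Counting walks of length 2 from
  \<open>u\<close> one finds, with \<open>d\<^sub>M(v)\<close> for the number of neighbours of \<open>v\<close> in \<open>M\<close> and \<open>e(M)\<close> for the
  number of edges inside \<open>M\<close>,

  \<open>\<Sum>\<^bsub>v\<in>N\<^esub> (d\<^sub>N(v) - 2) x\<^sub>v - e(N) \<ge> -3 + e(W) + \<Sum>\<^bsub>w\<in>W\<^esub> d\<^sub>N(w) (1 - x\<^sub>w)\<close>

  (lemma \<open>neighbourhood_inequality\<close>). The left-hand side is called the weighted excess of \<open>N\<close>.

  Suppose that some cycle length from 3 to 7 is missing. Then \<open>N\<close> contains no path on six vertices
  (lemma \<open>P6_free_N\<close>). It contains no 5-cycle either: that cycle would be a component of \<open>N\<close> with few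
  connections to \<open>W\<close>, whose total weight would be too small for the inequality (lemma \<open>C5_free_N\<close>).
  Now consider any graph without 6-vertex paths and 5-cycles. If its minimum degree is at least 3, it
  has a component \<open>K\<^sub>4\<close>, by inspection of a longest path. So, away from copies of \<open>K\<^sub>4\<close>, one can
  delete vertices of degree at most 2 one after the other. It follows that a graph on \<open>n \<ge> 2\<close>
  vertices without \<open>K\<^sub>4\<close> has at most \<open>2n - 3\<close> edges, with equality only for the books
  \<open>K\<^sub>2 \<nabla> (n - 2)K\<^sub>1\<close> (lemmas \<open>excess_le_minus3\<close> and \<open>excess_tight_book\<close>). For the weighted version,
  vertices of degree at most 1 are deleted first, each at the cost of its weight; because the total
  weight of \<open>N\<close> is at least \<open>\<lambda> \<ge> 7\<close>, neither an empty 2-core nor a copy of \<open>K\<^sub>4\<close> can survive, and the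
  weighted excess is at most \<open>-3\<close> (lemma \<open>weighted_excess_extremal\<close>).

  Hence equality holds everywhere. This forces \<open>N\<close> to be a book and \<open>W\<close> to be empty (theorem
  \<open>neighbourhood_is_book\<close>), so that \<open>G\<close> is the join of \<open>u\<close> and a book, that is, of a triangle and an
  independent set.
\<close>

section \<open>Paths, cycles and books\<close>

text \<open>
  A graph is given here by its adjacency relation alone. The vertex set is an argument of every
  notion below, so that a set \<open>M\<close> of vertices stands for the subgraph induced by \<open>M\<close> and passing to
  an induced subgraph costs nothing.
\<close>

locale adjacency =
  fixes E :: "'a \<Rightarrow> 'a \<Rightarrow> bool"
  assumes sym: "E u v \<Longrightarrow> E v u" and irrefl: "\<not> E v v"
begin

lemma sym_iff: "E u v \<longleftrightarrow> E v u"
  using sym by blast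

definition nbrs :: "'a set \<Rightarrow> 'a \<Rightarrow> 'a set" where
  "nbrs M v = {w \<in> M. E v w}"

definition deg :: "'a set \<Rightarrow> 'a \<Rightarrow> nat" where
  "deg M v = card (nbrs M v)"

definition is_path :: "'a set \<Rightarrow> 'a list \<Rightarrow> bool" where
  "is_path M xs \<longleftrightarrow> distinct xs \<and> set xs \<subseteq> M \<and> successively E xs"

text \<open>
  A cyclic list of vertices; it is a cycle of the graph once it has at least three entries.
\<close>

definition is_cycle :: "'a set \<Rightarrow> 'a list \<Rightarrow> bool" where
  "is_cycle M xs \<longleftrightarrow> is_path M xs \<and> E (last xs) (hd xs)"

text \<open>
  Lengths of lists count vertices. Excluding paths on exactly six vertices would amount to the same,
  since every initial segment of a path is a path.
\<close>

definition P6_free :: "'a set \<Rightarrow> bool" where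
  "P6_free M \<longleftrightarrow> (\<forall>xs. is_path M xs \<longrightarrow> length xs \<le> 5)"

definition C5_free :: "'a set \<Rightarrow> bool" where
  "C5_free M \<longleftrightarrow> (\<forall>xs. is_cycle M xs \<longrightarrow> length xs \<noteq> 5)"

definition is_clique :: "'a set \<Rightarrow> bool" where
  "is_clique Q \<longleftrightarrow> (\<forall>v\<in>Q. \<forall>w\<in>Q. v \<noteq> w \<longrightarrow> E v w)"

definition K4_free :: "'a set \<Rightarrow> bool" where
  "K4_free M \<longleftrightarrow> (\<forall>Q\<subseteq>M. is_clique Q \<longrightarrow> card Q \<noteq> 4)"

text \<open>
  The join of an edge and an independent set: triangles glued along the common edge \<open>ab\<close>. The
  vertices \<open>a\<close> and \<open>b\<close> are called hubs, the other ones pages.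
\<close>

definition is_book :: "'a \<Rightarrow> 'a \<Rightarrow> 'a set \<Rightarrow> bool" where
  "is_book a b M \<longleftrightarrow> a \<in> M \<and> b \<in> M \<and> E a b \<and>
     (\<forall>c\<in>M - {a, b}. E a c \<and> E b c \<and> (\<forall>d\<in>M - {a, b}. \<not> E c d))"

section \<open>The weighted excess\<close>

text \<open>
  In terms of the edges of the induced subgraph this is
  \<open>\<Sum>\<^bsub>vw\<^esub> (x\<^sub>v + x\<^sub>w - 1) - 2 \<Sum>\<^bsub>v\<^esub> x\<^sub>v\<close>. For weights in the unit interval an edge contributes at
  most the smaller of its two end weights, which is why deleting a vertex \<open>v\<close> of degree \<open>k\<close>
  raises the value by at least \<open>(2 - k) x\<^sub>v\<close>. For constant weight 1 the value is the
  number of edges minus twice the number of vertices.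
\<close>

definition weighted_excess :: "('a \<Rightarrow> real) \<Rightarrow> 'a set \<Rightarrow> real" where
  "weighted_excess x M = (\<Sum>v\<in>M. real (deg M v) * (x v - 1/2) - 2 * x v)"

lemma weighted_excess_empty [simp]: "weighted_excess x {} = 0"
  by (simp add: weighted_excess_def)

lemma path_mono: "is_path M xs \<Longrightarrow> M \<subseteq> M' \<Longrightarrow> is_path M' xs"
  unfolding is_path_def by blast

lemma cycle_mono: "is_cycle M xs \<Longrightarrow> M \<subseteq> M' \<Longrightarrow> is_cycle M' xs"
  unfolding is_cycle_def using path_mono by blast

lemma P6_free_mono: "P6_free M' \<Longrightarrow> M \<subseteq> M' \<Longrightarrow> P6_free M"
  unfolding P6_free_def using path_mono by blast

lemma C5_free_mono: "C5_free M' \<Longrightarrow> M \<subseteq> M' \<Longrightarrow> C5_free M"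
  unfolding C5_free_def using cycle_mono by blast

lemma K4_free_mono: "K4_free M' \<Longrightarrow> M \<subseteq> M' \<Longrightarrow> K4_free M"
  unfolding K4_free_def by blast

lemma finite_nbrs [simp]: "finite M \<Longrightarrow> finite (nbrs M v)"
  by (simp add: nbrs_def)

lemma deg_less_card: "finite M \<Longrightarrow> v \<in> M \<Longrightarrow> deg M v < card M"
  unfolding deg_def nbrs_def using irrefl by (intro psubset_card_mono) auto

lemma nbrs_subset: "nbrs M v \<subseteq> M"
  by (auto simp: nbrs_def)

lemma weighted_excess_insert:
  assumes "finite M" "v \<notin> M"
  shows "weighted_excess x (insert v M)
    = weighted_excess x M + (\<Sum>w\<in>nbrs M v. x v + x w - 1) - 2 * x v"
proof -
  have dv: "deg (insert v M) v = deg M v"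
    using irrefl by (auto simp: deg_def nbrs_def intro!: arg_cong[of _ _ card])
  have dw: "real (deg (insert v M) w) = real (deg M w) + of_bool (E v w)" if "w \<in> M" for w
  proof (cases "E v w")
    case True
    then have "nbrs (insert v M) w = insert v (nbrs M w)" by (auto simp: nbrs_def sym)
    moreover have "v \<notin> nbrs M w" using assms by (auto simp: nbrs_def)
    ultimately show ?thesis using True assms by (simp add: deg_def)
  next
    case False
    then have "nbrs (insert v M) w = nbrs M w" by (auto simp: nbrs_def sym_iff)
    then show ?thesis using False by (simp add: deg_def)
  qed
  have "weighted_excess x (insert v M) = real (deg M v) * (x v - 1/2) - 2 * x v
      + (\<Sum>w\<in>M. (real (deg M w) + of_bool (E v w)) * (x w - 1/2) - 2 * x w)"
    using assms dv dw by (simp add: weighted_excess_def)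
  also have "(\<Sum>w\<in>M. (real (deg M w) + of_bool (E v w)) * (x w - 1/2) - 2 * x w)
      = weighted_excess x M + (\<Sum>w\<in>M. of_bool (E v w) * (x w - 1/2))"
    unfolding weighted_excess_def sum.distrib[symmetric] by (intro sum.cong) (auto simp: algebra_simps)
  also have "(\<Sum>w\<in>M. of_bool (E v w) * (x w - 1/2)) = (\<Sum>w\<in>nbrs M v. x w - 1/2)"
    unfolding nbrs_def sum.inter_filter[OF assms(1)] by (intro sum.cong) auto
  also have "real (deg M v) * (x v - 1/2) = (\<Sum>w\<in>nbrs M v. x v - 1/2)"
    by (simp add: deg_def)
  finally show ?thesis by (simp add: sum.distrib sum_subtractf algebra_simps)
qed

lemma weighted_excess_remove_low:
  assumes "finite M" "v \<in> M" "deg M v \<le> k" and x: "\<And>w. w \<in> M \<Longrightarrow> x w \<in> {0..1}"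
  shows "weighted_excess x M \<le> weighted_excess x (M - {v}) + (real k - 2) * x v"
proof -
  have nb: "nbrs (M - {v}) v = nbrs M v" using irrefl by (auto simp: nbrs_def)
  have "weighted_excess x M = weighted_excess x (M - {v}) + (\<Sum>w\<in>nbrs M v. x v + x w - 1) - 2 * x v"
    using weighted_excess_insert[of "M - {v}" v x] assms(1,2) nb by (simp add: insert_absorb)
  also have "(\<Sum>w\<in>nbrs M v. x v + x w - 1) \<le> (\<Sum>w\<in>nbrs M v. x v)"
    using x by (intro sum_mono) (auto simp: nbrs_def)
  also have "\<dots> = deg M v * x v" by (simp add: deg_def)
  also have "\<dots> \<le> k * x v" using assms x[of v] by (intro mult_right_mono) auto
  finally show ?thesis by (simp add: algebra_simps)
qed

text \<open>
  \<open>C\<close> is a union of connected components of the graph induced by \<open>M\<close>.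
\<close>

definition closed_in :: "'a set \<Rightarrow> 'a set \<Rightarrow> bool" where
  "closed_in M C \<longleftrightarrow> C \<subseteq> M \<and> (\<forall>v\<in>C. \<forall>w\<in>M. E v w \<longrightarrow> w \<in> C)"

lemma weighted_excess_split:
  assumes "finite M" "closed_in M C"
  shows "weighted_excess x M = weighted_excess x C + weighted_excess x (M - C)"
proof -
  have "deg M v = deg C v" if "v \<in> C" for v
    using that assms unfolding deg_def nbrs_def closed_in_def by (metis subset_iff)
  moreover have "deg M v = deg (M - C) v" if "v \<in> M - C" for v
  proof -
    have "nbrs M v = nbrs (M - C) v"
      using that assms sym unfolding nbrs_def closed_in_def by blast
    then show ?thesis by (simp add: deg_def)
  qed
  moreover have "C \<subseteq> M" using assms by (simp add: closed_in_def)
  then have "weighted_excess x M = (\<Sum>v\<in>C. real (deg M v) * (x v - 1/2) - 2 * x v)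
      + (\<Sum>v\<in>M - C. real (deg M v) * (x v - 1/2) - 2 * x v)"
    unfolding weighted_excess_def using sum.subset_diff[OF _ assms(1)] by (simp add: add.commute)
  ultimately show ?thesis unfolding weighted_excess_def by simp
qed

lemma is_clique4I:
  assumes "card Q = 4" "\<And>v. v \<in> Q \<Longrightarrow> deg Q v \<ge> 3"
  shows "is_clique Q"
  unfolding is_clique_def
proof (intro ballI impI)
  fix v w assume *: "v \<in> Q" "w \<in> Q" "v \<noteq> w"
  have fin: "finite Q" using assms(1) card.infinite by fastforce
  show "E v w"
  proof (rule ccontr)
    assume "\<not> E v w"
    then have "nbrs Q v \<subseteq> Q - {v, w}" using irrefl by (auto simp: nbrs_def)
    then have "deg Q v \<le> card (Q - {v, w})" unfolding deg_def using fin by (intro card_mono) auto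
    also have "\<dots> = 2" using * assms(1) fin by (simp add: card_Diff_subset)
    finally show False using assms(2)[OF *(1)] by simp
  qed
qed

lemma exists_longest_path:
  assumes "P6_free M" "v \<in> M"
  obtains xs where "is_path M xs" "xs \<noteq> []" "\<And>ys. is_path M ys \<Longrightarrow> length ys \<le> length xs"
proof -
  have "is_path M [v]" using assms by (simp add: is_path_def)
  moreover have "\<forall>ys. is_path M ys \<longrightarrow> length ys < 6"
    using assms by (auto simp: P6_free_def less_Suc_eq_le numeral_eq_Suc)
  ultimately have "\<exists>xs. is_path M xs \<and> (\<forall>ys. is_path M ys \<longrightarrow> length ys \<le> length xs)"
    by (rule ex_has_greatest_nat[of "is_path M" "[v]" length 6])
  then obtain xs where xs: "is_path M xs" "\<And>ys. is_path M ys \<Longrightarrow> length ys \<le> length xs"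
    by blast
  from xs(2)[OF \<open>is_path M [v]\<close>] have "xs \<noteq> []" by auto
  with xs show ?thesis using that by blast
qed

lemma nbrs_subset_longest_path:
  assumes "is_path M (a # xs)" "\<And>ys. is_path M ys \<Longrightarrow> length ys \<le> length (a # xs)"
  shows "nbrs M a \<subseteq> set xs"
proof
  fix w assume w: "w \<in> nbrs M a"
  then have wa: "w \<in> M" "E w a" "w \<noteq> a" using irrefl sym by (auto simp: nbrs_def)
  show "w \<in> set xs"
  proof (rule ccontr)
    assume "w \<notin> set xs"
    with wa assms(1) have "is_path M (w # a # xs)" by (auto simp: is_path_def)
    from assms(2)[OF this] show False by simp
  qed
qed

lemma path_rev: "is_path M xs \<Longrightarrow> is_path M (rev xs)"
proof -
  assume "is_path M xs"
  moreover from this have "successively (\<lambda>u v. E v u) xs"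
    unfolding is_path_def using successively_mono[of E xs "\<lambda>u v. E v u"] sym by blast
  ultimately show "is_path M (rev xs)" by (simp add: is_path_def)
qed

section \<open>Graphs without paths on six vertices\<close>

text \<open>
  All neighbours of an end of a longest path lie on that path, which has at most five vertices. With
  minimum degree 3 the path therefore has four or five vertices. Four vertices span a component in
  which everybody has degree 3. On a path \<open>abcde\<close> either the ends are adjacent, or both are adjacent
  to \<open>b\<close>, \<open>c\<close>, \<open>d\<close>; then \<open>abedc\<close> is a 5-cycle.
\<close>

lemma min_deg3_component:
  assumes "finite M" "M \<noteq> {}" "P6_free M" and d3: "\<And>v. v \<in> M \<Longrightarrow> deg M v \<ge> 3"
  obtains (K4) Q where "closed_in M Q" "is_clique Q" "card Q = 4"
  | (C5) xs where "is_cycle M xs" "length xs = 5"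
proof -
  obtain v where "v \<in> M" using assms(2) by blast
  then obtain xs where xs: "is_path M xs" "xs \<noteq> []"
    and max: "\<And>ys. is_path M ys \<Longrightarrow> length ys \<le> length xs"
    using exists_longest_path[OF assms(3)] by blast
  have end_nbrs: "nbrs M a \<subseteq> set ys" if "is_path M (a # ys)" "length ys = length xs - 1" for a ys
    using nbrs_subset_longest_path[OF that(1)] max that(2) xs(2) by (cases xs) auto
  have ge3: "card A \<ge> 3" if "a \<in> M" "nbrs M a \<subseteq> A" "finite A" for a A
    using d3[OF that(1)] card_mono[OF that(3,2)] by (simp add: deg_def)
  have len5: "length xs \<le> 5" using xs assms(3) by (simp add: P6_free_def)
  obtain a ys where ays: "xs = a # ys" using xs(2) by (cases xs) auto
  have aM: "a \<in> M" using xs(1) ays by (simp add: is_path_def)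
  have "nbrs M a \<subseteq> set ys" using end_nbrs[of a ys] xs ays by simp
  from ge3[OF aM this] have "length ys \<ge> 3" using card_length[of ys] by simp
  with len5 ays consider b c d where "ys = [b,c,d]" | b c d e where "ys = [b,c,d,e]"
    by (auto simp: numeral_eq_Suc Suc_le_length_iff le_Suc_eq length_Suc_conv)
  then show ?thesis
  proof cases
    case (1 b c d)
    let ?Q = "{a,b,c,d}"
    have p: "is_path M [a,b,c,d]" using xs(1) ays 1 by simp
    have len: "length xs = 4" using ays 1 by simp
    have Na: "nbrs M a \<subseteq> {b,c,d}" using end_nbrs[of a "[b,c,d]"] p len by simp
    have "nbrs M a = {b,c,d}"
      using Na d3[OF aM] card_subset_eq[of "{b,c,d}" "nbrs M a"] card_mono[OF _ Na] p
      by (simp add: deg_def is_path_def)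
    then have ad: "E a b" "E a c" "E a d" by (auto simp: nbrs_def)
    \<comment> \<open>The four vertices lie on a 4-cycle, so each of them is the end of a longest path.\<close>
    have "is_path M [d,c,b,a]" "is_path M [b,c,d,a]" "is_path M [c,b,a,d]"
      using p ad by (auto simp: is_path_def sym)
    then have Nb: "nbrs M d \<subseteq> {c,b,a}" "nbrs M b \<subseteq> {c,d,a}" "nbrs M c \<subseteq> {b,a,d}"
      using end_nbrs[of d "[c,b,a]"] end_nbrs[of b "[c,d,a]"] end_nbrs[of c "[b,a,d]"] len
      by auto
    have cl: "closed_in M ?Q"
      using p Na Nb by (auto simp: closed_in_def is_path_def nbrs_def)
    have card: "card ?Q = 4" using p by (simp add: is_path_def)
    have "deg ?Q w \<ge> 3" if "w \<in> ?Q" for w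
    proof -
      have "nbrs ?Q w = nbrs M w" using cl that by (auto simp: closed_in_def nbrs_def)
      then show ?thesis using d3[of w] cl that unfolding closed_in_def deg_def by auto
    qed
    from K4[OF cl is_clique4I[OF card this] card] show ?thesis .
  next
    case (2 b c d e)
    have p: "is_path M [a,b,c,d,e]" using xs(1) ays 2 by simp
    have len: "length xs = 5" using ays 2 by simp
    have Na: "nbrs M a \<subseteq> {b,c,d,e}" using end_nbrs[of a "[b,c,d,e]"] p len by simp
    have Ne: "nbrs M e \<subseteq> {d,c,b,a}"
      using end_nbrs[of e "[d,c,b,a]"] path_rev[OF p] len by simp
    have eM: "e \<in> M" using p by (simp add: is_path_def)
    show ?thesis
    proof (cases "E a e")
      case True
      with p have "is_cycle M [a,b,c,d,e]" by (auto simp: is_cycle_def sym)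
      from C5[OF this] show ?thesis by simp
    next
      case False
      then have Na: "nbrs M a \<subseteq> {b,c,d}" and Ne: "nbrs M e \<subseteq> {b,c,d}"
        using Na Ne sym by (auto simp: nbrs_def)
      have "nbrs M a = {b,c,d}"
        using Na d3[OF aM] card_subset_eq[of "{b,c,d}" "nbrs M a"] card_mono[OF _ Na] p
        by (simp add: deg_def is_path_def)
      moreover have "nbrs M e = {b,c,d}"
        using Ne d3[OF eM] card_subset_eq[of "{b,c,d}" "nbrs M e"] card_mono[OF _ Ne] p
        by (simp add: deg_def is_path_def)
      ultimately have "E a c" "E e b" by (auto simp: nbrs_def)
      with p have "is_cycle M [a,b,e,d,c]" by (auto simp: is_cycle_def is_path_def sym)
      from C5[OF this] show ?thesis by simp
    qed
  qed
qed

text \<open>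
  A vertex attached to a 5-cycle from outside extends it to a path on six vertices.
\<close>

lemma C5_closed:
  assumes "P6_free M" "is_cycle M xs" "length xs = 5"
  shows "closed_in M (set xs)"
  unfolding closed_in_def
proof (intro conjI ballI impI)
  show "set xs \<subseteq> M" using assms by (simp add: is_cycle_def is_path_def)
  fix v w assume vw: "v \<in> set xs" "w \<in> M" "E v w"
  obtain a b c d e where xs: "xs = [a,b,c,d,e]"
    using assms(3) by (auto simp: numeral_eq_Suc length_Suc_conv)
  show "w \<in> set xs"
  proof (rule ccontr)
    assume w: "w \<notin> set xs"
    have c: "is_cycle M [a,b,c,d,e]" using assms(2) xs by simp
    have cE: "E a b" "E b c" "E c d" "E d e" "E e a" and M: "distinct [w,a,b,c,d,e]" "set [w,a,b,c,d,e] \<subseteq> M"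
      using c w xs vw(2) by (auto simp: is_cycle_def is_path_def)
    have "\<exists>ys. is_path M ys \<and> length ys = 6"
    proof -
      from vw(1) xs consider "v = a" | "v = b" | "v = c" | "v = d" | "v = e" by auto
      then show ?thesis
      proof cases
        case 1 then show ?thesis using cE M sym[OF vw(3)]
          by (intro exI[of _ "[w,a,b,c,d,e]"]) (simp add: is_path_def)
      next
        case 2 then show ?thesis using cE M sym[OF vw(3)]
          by (intro exI[of _ "[w,b,c,d,e,a]"]) (auto simp: is_path_def)
      next
        case 3 then show ?thesis using cE M sym[OF vw(3)]
          by (intro exI[of _ "[w,c,d,e,a,b]"]) (auto simp: is_path_def)
      next
        case 4 then show ?thesis using cE M sym[OF vw(3)]
          by (intro exI[of _ "[w,d,e,a,b,c]"]) (auto simp: is_path_def)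
      next
        case 5 then show ?thesis using cE M sym[OF vw(3)]
          by (intro exI[of _ "[w,e,a,b,c,d]"]) (auto simp: is_path_def)
      qed
    qed
    then show False using assms(1) by (fastforce simp: P6_free_def)
  qed
qed

abbreviation excess :: "'a set \<Rightarrow> real" where
  "excess \<equiv> weighted_excess (\<lambda>_. 1)"

text \<open>
  The coefficient of \<open>x\<^sub>v\<close> is the degree of \<open>v\<close> minus 2, so the maximum is attained at weight 1.
\<close>

lemma weighted_excess_le_excess:
  assumes "\<And>v. v \<in> M \<Longrightarrow> deg M v \<ge> 2" "\<And>v. v \<in> M \<Longrightarrow> x v \<in> {0..1}"
  shows "weighted_excess x M \<le> excess M"
  unfolding weighted_excess_def
proof (rule sum_mono)
  fix v assume v: "v \<in> M"
  have "(real (deg M v) - 2) * x v \<le> (real (deg M v) - 2) * 1"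
    using assms[OF v] by (intro mult_left_mono) auto
  then show "real (deg M v) * (x v - 1/2) - 2 * x v \<le> real (deg M v) * (1 - 1/2) - 2 * 1"
    by (simp add: algebra_simps)
qed

text \<open>
  A vertex of degree \<open>d \<le> 4\<close> contributes an affine function of its weight, with the value
  \<open>-d/2\<close> at weight 0 and \<open>d/2 - 2\<close> at weight 1.
\<close>

lemma weighted_excess_nonpos_small:
  assumes "finite M" "card M \<le> 5" "\<And>v. v \<in> M \<Longrightarrow> x v \<in> {0..1}"
  shows "weighted_excess x M \<le> 0"
  unfolding weighted_excess_def
proof (rule sum_nonpos)
  fix v assume v: "v \<in> M"
  have "real (deg M v) \<le> 4" using deg_less_card[OF assms(1) v] assms(2) by simp
  then have "0 \<le> x v * (4 - real (deg M v))" "0 \<le> (1 - x v) * real (deg M v)"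
    using assms(3)[OF v] by (auto intro!: mult_nonneg_nonneg)
  then show "real (deg M v) * (x v - 1/2) - 2 * x v \<le> 0"
    by (simp add: algebra_simps)
qed

text \<open>
  Vertices of degree at most 2 can be deleted, and when there are none, a component of at most five
  vertices can be split off.
\<close>

lemma weighted_excess_nonpos:
  assumes "finite M" "P6_free M" "\<And>v. v \<in> M \<Longrightarrow> x v \<in> {0..1}"
  shows "weighted_excess x M \<le> 0"
  using assms
proof (induction M rule: finite_psubset_induct)
  case (psubset M)
  have IH: "weighted_excess x M' \<le> 0" if "M' \<subset> M" for M'
    using that psubset.IH[of M'] psubset.prems P6_free_mono[of M M'] by blast
  have step: "weighted_excess x M \<le> 0" if C: "closed_in M C" "card C \<le> 5" "C \<noteq> {}" for C
  proof -
    have CM: "C \<subseteq> M" using C by (simp add: closed_in_def)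
    have "weighted_excess x C \<le> 0"
      using CM C psubset.prems finite_subset[OF CM psubset.hyps] by (intro weighted_excess_nonpos_small) auto
    moreover have "weighted_excess x (M - C) \<le> 0" using CM C by (intro IH) blast
    ultimately show ?thesis using weighted_excess_split[OF psubset.hyps C(1), of x] by simp
  qed
  consider "M = {}" | v where "v \<in> M" "deg M v \<le> 2" | "M \<noteq> {}" "\<And>v. v \<in> M \<Longrightarrow> deg M v \<ge> 3"
    by fastforce
  then show ?case
  proof cases
    case (2 v)
    have "weighted_excess x M \<le> weighted_excess x (M - {v})"
      using weighted_excess_remove_low[OF psubset.hyps 2, of x] psubset.prems by simp
    then show ?thesis using IH[of "M - {v}"] 2 by force
  next
    case 3
    consider (K4) Q where "closed_in M Q" "card Q = 4" | (C5) xs where "is_cycle M xs" "length xs = 5"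
      using min_deg3_component[OF psubset.hyps 3(1) psubset.prems(1) 3(2)] by blast
    then show ?thesis
    proof cases
      case (K4 Q)
      then show ?thesis using step[of Q] by fastforce
    next
      case (C5 xs)
      have "card (set xs) = 5" using C5 by (simp add: is_cycle_def is_path_def distinct_card)
      then show ?thesis using step[OF C5_closed[OF psubset.prems(1) C5]] by fastforce
    qed
  qed simp
qed

lemma excess_small:
  assumes "card M = n" "n > 0"
  shows "excess M \<le> real n * ((real n - 1) / 2 - 2)"
proof -
  have fin: "finite M" using assms card_gt_0_iff by metis
  have "excess M \<le> (\<Sum>v\<in>M. (real n - 1) / 2 - 2)"
    unfolding weighted_excess_def
  proof (rule sum_mono)
    fix v assume "v \<in> M"
    then have "Suc (deg M v) \<le> n" using deg_less_card[OF fin, of v] assms by simp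
    then have "real (deg M v) \<le> real n - 1" by linarith
    then show "real (deg M v) * (1 - 1/2) - 2 * 1 \<le> (real n - 1) / 2 - 2" by simp
  qed
  then show ?thesis using assms by simp
qed

section \<open>Graphs without 6-vertex paths and 5-cycles\<close>

lemma low_degree_or_closed_K4:
  assumes "finite M" "M \<noteq> {}" "P6_free M" "C5_free M"
  obtains (low) v where "v \<in> M" "deg M v \<le> 2"
  | (K4) Q where "closed_in M Q" "is_clique Q" "card Q = 4"
proof (cases "\<exists>v\<in>M. deg M v \<le> 2")
  case True
  then show ?thesis using low by blast
next
  case False
  then have "\<And>v. v \<in> M \<Longrightarrow> deg M v \<ge> 3" by force
  from min_deg3_component[OF assms(1-3) this] K4 assms(4) show ?thesis
    unfolding C5_free_def by blast
qed

text \<open>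
  The value \<open>-2\<close> is attained by a single vertex and by \<open>K\<^sub>4\<close>; these are the two ways in which the
  stripping of low degree vertices can end.
\<close>

lemma excess_le_minus2:
  assumes "finite M" "M \<noteq> {}" "P6_free M" "C5_free M"
  shows "excess M \<le> -2"
  using assms
proof (induction M rule: finite_psubset_induct)
  case (psubset M)
  have IH: "excess M' \<le> -2" if "M' \<subset> M" "M' \<noteq> {}" for M'
    using that psubset.IH[of M'] psubset.prems P6_free_mono[of M M'] C5_free_mono[of M M'] by blast
  consider (low) v where "v \<in> M" "deg M v \<le> 2"
    | (K4) Q where "closed_in M Q" "card Q = 4"
    using low_degree_or_closed_K4[OF psubset.hyps psubset.prems] by blast
  then show ?case
  proof cases
    case (low v)
    show ?thesis
    proof (cases "M = {v}")
      case True
      then show ?thesis using excess_small[of M 1] by simp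
    next
      case False
      then have "excess (M - {v}) \<le> -2" using low by (intro IH) auto
      moreover have "excess M \<le> excess (M - {v})"
        using weighted_excess_remove_low[OF psubset.hyps low, of "\<lambda>_. 1"] by simp
      ultimately show ?thesis by simp
    qed
  next
    case (K4 Q)
    have "excess (M - Q) \<le> 0"
      using psubset.hyps P6_free_mono[OF psubset.prems(2)] by (intro weighted_excess_nonpos) auto
    then show ?thesis
      using weighted_excess_split[OF psubset.hyps K4(1), of "\<lambda>_. 1"] excess_small[OF K4(2)] by simp
  qed
qed

lemma low_degree:
  assumes "finite M" "M \<noteq> {}" "P6_free M" "C5_free M" "K4_free M"
  obtains v where "v \<in> M" "deg M v \<le> 2"
proof -
  have "\<not> (closed_in M Q \<and> is_clique Q \<and> card Q = 4)" for Q
    using assms(5) by (auto simp: K4_free_def closed_in_def)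
  then show ?thesis using low_degree_or_closed_K4[OF assms(1-4)] that by blast
qed

lemma excess_le_minus3:
  assumes "card M \<ge> 2" "P6_free M" "C5_free M" "K4_free M"
  shows "excess M \<le> -3"
  using assms
proof (induction "card M" arbitrary: M rule: nat_induct_at_least)
  case base
  then show ?case using excess_small[of M 2] by simp
next
  case (Suc n)
  have fin: "finite M" using Suc.hyps by (metis card.infinite nat.distinct(1))
  have "M \<noteq> {}" using Suc.hyps by auto
  from low_degree[OF fin this Suc.prems(1-3)] obtain v where v: "v \<in> M" "deg M v \<le> 2" .
  have "excess (M - {v}) \<le> -3"
    using Suc.hyps Suc.prems v P6_free_mono[of M "M - {v}"] C5_free_mono[of M "M - {v}"]
      K4_free_mono[of M "M - {v}"] by (intro Suc.hyps(2)) auto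
  moreover have "excess M \<le> excess (M - {v})"
    using weighted_excess_remove_low[OF fin v, of "\<lambda>_. 1"] by simp
  ultimately show ?case by simp
qed

lemma book_commute: "is_book a b M \<Longrightarrow> is_book b a M"
  using sym by (auto simp: is_book_def)

lemma book_page:
  assumes "is_book a b M" "c \<in> M - {a, b}"
  shows "E a c" "E c a" "E b c" "E c b" "c \<noteq> a" "c \<noteq> b" "c \<in> M"
  using assms sym by (auto simp: is_book_def)

lemma book_hubs:
  assumes "is_book a b M"
  shows "E a b" "E b a" "a \<noteq> b" "a \<in> M" "b \<in> M"
  using assms sym irrefl by (auto simp: is_book_def)

text \<open>
  A new vertex joined to the hub \<open>a\<close> and the page \<open>c\<close> closes the 5-cycle \<open>vadbc\<close> as soon as there is
  a second page \<open>d\<close>. Otherwise the book is a triangle, and its edge \<open>ac\<close> may serve as the spine.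
\<close>

lemma book_insert_hub_page:
  assumes book: "is_book a b M" and v: "v \<notin> M" and N: "nbrs M v = {a, c}"
    and c: "c \<in> M - {a, b}" and C5: "C5_free (insert v M)"
  shows "is_book a c (insert v M)"
proof -
  note hubs = book_hubs[OF book] and page = book_page[OF book c]
  have vE: "E v a" "E v c" "E a v" "E c v" and vb: "\<not> E v b" "\<not> E b v"
  proof -
    have iff: "E v w \<longleftrightarrow> w = a \<or> w = c" if "w \<in> M" for w
      using N that unfolding nbrs_def by blast
    show "E v a" "E v c" "E a v" "E c v" "\<not> E v b" "\<not> E b v"
      using iff[of a] iff[of c] iff[of b] hubs page sym by auto
  qed
  have "M = {a, b, c}"
  proof (rule ccontr)
    assume "M \<noteq> {a, b, c}"
    then obtain d where d: "d \<in> M - {a, b}" "d \<noteq> c" using c hubs by blast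
    note paged = book_page[OF book d(1)]
    have "distinct [v, a, d, b, c]" using hubs page paged d v by auto
    then have "is_cycle (insert v M) [v, a, d, b, c]"
      using hubs page paged vE by (simp add: is_cycle_def is_path_def)
    then show False using C5 by (auto simp: C5_free_def)
  qed
  moreover have "v \<noteq> a" "v \<noteq> b" "v \<noteq> c" using hubs page v by auto
  ultimately show ?thesis
    using hubs page vE vb irrefl unfolding is_book_def by auto
qed

text \<open>
  A new vertex of degree 2 must be joined to the two hubs, up to the choice of the spine in a
  triangle: two pages \<open>p\<close> and \<open>q\<close> would give the 5-cycle \<open>vpabq\<close>.
\<close>

lemma book_insert:
  assumes book: "is_book a b M" and v: "v \<notin> M" and N: "nbrs M v = {p, q}" "p \<noteq> q"
    and C5: "C5_free (insert v M)"
  shows "\<exists>a b. is_book a b (insert v M)"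
proof -
  note hubs = book_hubs[OF book]
  have pq: "p \<in> M" "q \<in> M" using N by (auto simp: nbrs_def)
  have swap: "{p, q} = {q, p}" by blast
  consider (hubs) "{p, q} = {a, b}" | (mixed) "p \<in> {a, b}" "q \<in> M - {a, b}"
    | (mixed') "q \<in> {a, b}" "p \<in> M - {a, b}" | (pages) "p \<in> M - {a, b}" "q \<in> M - {a, b}"
    using pq N(2) by blast
  then show ?thesis
  proof cases
    case hubs
    then have "nbrs M v = {a, b}" using N by simp
    then have "E v w \<longleftrightarrow> w = a \<or> w = b" "E w v \<longleftrightarrow> w = a \<or> w = b" if "w \<in> M" for w
      using that sym by (auto simp: nbrs_def)
    then have "is_book a b (insert v M)"
      using book v irrefl unfolding is_book_def by auto
    then show ?thesis by blast
  next
    case mixed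
    then show ?thesis
      using book_insert_hub_page[OF book v _ _ C5, of q] N
        book_insert_hub_page[OF book_commute[OF book] v _ _ C5, of q]
      by (metis insert_commute insert_iff singletonD)
  next
    case mixed'
    then show ?thesis
      using book_insert_hub_page[OF book v _ _ C5, of p] N swap
        book_insert_hub_page[OF book_commute[OF book] v _ _ C5, of p]
      by (metis insert_commute insert_iff singletonD)
  next
    case pages
    note pp = book_page[OF book pages(1)] and qq = book_page[OF book pages(2)]
    have "E v p" "E q v" using N sym by (auto simp: nbrs_def)
    moreover have "distinct [v, p, a, b, q]" using hubs pp qq N(2) v by auto
    ultimately have "is_cycle (insert v M) [v, p, a, b, q]"
      using book_hubs[OF book] pp qq by (simp add: is_cycle_def is_path_def)
    then show ?thesis using C5 by (auto simp: C5_free_def)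
  qed
qed

text \<open>
  In the tight case the deleted vertex has degree exactly 2 and the remaining graph is tight again,
  so the graph is built from a single edge by adding vertices of degree 2.
\<close>

lemma excess_tight_book:
  assumes "card M \<ge> 2" "P6_free M" "C5_free M" "K4_free M" "excess M = -3"
  shows "\<exists>a b. is_book a b M"
  using assms
proof (induction "card M" arbitrary: M rule: nat_induct_at_least)
  case base
  then obtain a b where M: "M = {a, b}" "a \<noteq> b" by (metis card_2_iff)
  have "E a b"
  proof (rule ccontr)
    assume "\<not> E a b"
    then have "deg M a = 0" "deg M b = 0"
      using M irrefl sym by (auto simp: deg_def nbrs_def)
    then show False using base.prems M by (simp add: weighted_excess_def)
  qed
  with M show ?case by (auto simp: is_book_def)
next
  case (Suc n)
  have fin: "finite M" using Suc.hyps by (metis card.infinite nat.distinct(1))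
  have "M \<noteq> {}" using Suc.hyps by auto
  from low_degree[OF fin this Suc.prems(1-3)] obtain v where v: "v \<in> M" "deg M v \<le> 2" .
  define M' where "M' = M - {v}"
  have M': "M = insert v M'" "v \<notin> M'" "finite M'" "card M' = n"
    using v fin Suc.hyps by (auto simp: M'_def)
  have free: "P6_free M'" "C5_free M'" "K4_free M'"
    using Suc.prems P6_free_mono[of M M'] C5_free_mono[of M M'] K4_free_mono[of M M']
    by (auto simp: M'_def)
  have nb: "nbrs M v = nbrs M' v" using irrefl by (auto simp: nbrs_def M'_def)
  have eq: "excess M = excess M' + real (deg M v) - 2"
    using weighted_excess_insert[OF M'(3,2), of "\<lambda>_. 1"] M'(1) nb by (simp add: deg_def)
  have "excess M' \<le> -3" using excess_le_minus3[OF _ free] M' Suc.hyps by simp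
  with eq v(2) Suc.prems(4) have tight: "excess M' = -3" and d2: "deg M v = 2" by simp_all
  from Suc.hyps(2)[of M'] M' free tight Suc.hyps(1) obtain a b where "is_book a b M'"
    by auto
  moreover from d2 nb obtain p q where "nbrs M' v = {p, q}" "p \<noteq> q"
    unfolding deg_def by (metis card_2_iff)
  ultimately show ?case using book_insert[OF _ M'(2)] Suc.prems(2) M'(1) by metis
qed

text \<open>
  A vertex of degree at most 1 lowers the weighted excess by at least its weight. This keeps track of
  the parts of the graph, such as isolated vertices and trees, that edge counting does not see.
\<close>

lemma two_core:
  assumes "finite M" "\<And>v. v \<in> M \<Longrightarrow> x v \<in> {0..1}"
  shows "\<exists>K\<subseteq>M. (\<forall>v\<in>K. deg K v \<ge> 2) \<and> weighted_excess x M \<le> weighted_excess x K - sum x (M - K)"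
  using assms
proof (induction M rule: finite_psubset_induct)
  case (psubset M)
  show ?case
  proof (cases "\<forall>v\<in>M. deg M v \<ge> 2")
    case True
    then show ?thesis by (intro exI[of _ M]) auto
  next
    case False
    then obtain v where v: "v \<in> M" "deg M v \<le> 1" by force
    have "\<exists>K\<subseteq>M - {v}. (\<forall>w\<in>K. deg K w \<ge> 2) \<and> weighted_excess x (M - {v}) \<le> weighted_excess x K - sum x (M - {v} - K)"
      using v psubset.prems by (intro psubset.IH) auto
    then obtain K where K: "K \<subseteq> M - {v}" "\<forall>w\<in>K. deg K w \<ge> 2"
      "weighted_excess x (M - {v}) \<le> weighted_excess x K - sum x (M - {v} - K)" by blast
    have "M - K = insert v (M - {v} - K)" using v K by blast
    then have "sum x (M - K) = x v + sum x (M - {v} - K)"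
      using psubset.hyps by simp
    moreover have "weighted_excess x M \<le> weighted_excess x (M - {v}) - x v"
      using weighted_excess_remove_low[OF psubset.hyps v, of x] psubset.prems by simp
    ultimately show ?thesis using K by (intro exI[of _ K]) auto
  qed
qed

text \<open>
  Let \<open>y\<close> outside \<open>Q\<close> be adjacent to \<open>a\<close> in \<open>Q\<close>. By its degree \<open>y\<close> has another neighbour. One inside
  \<open>Q\<close> gives a 5-cycle, and one outside \<open>Q\<close> gives a path on six vertices.
\<close>

lemma K4_closed:
  assumes "finite M" "P6_free M" "C5_free M" and d2: "\<And>v. v \<in> M \<Longrightarrow> deg M v \<ge> 2"
    and Q: "Q \<subseteq> M" "is_clique Q" "card Q = 4"
  shows "closed_in M Q"
  unfolding closed_in_def
proof (intro conjI ballI impI)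
  show "Q \<subseteq> M" by fact
  fix a y assume ay: "a \<in> Q" "y \<in> M" "E a y"
  show "y \<in> Q"
  proof (rule ccontr)
    assume yQ: "y \<notin> Q"
    have fin: "finite Q" using Q(1) assms(1) finite_subset by blast
    have "\<not> nbrs M y \<subseteq> {a}"
    proof
      assume "nbrs M y \<subseteq> {a}"
      from card_mono[OF _ this] have "deg M y \<le> 1" by (simp add: deg_def)
      then show False using d2[OF ay(2)] by simp
    qed
    then obtain z where z: "z \<in> M" "E y z" "z \<noteq> a" by (auto simp: nbrs_def)
    have zy: "z \<noteq> y" "y \<noteq> a" using z yQ ay irrefl by auto
    have card3: "card (Q - {a}) = 3" using Q(3) ay(1) fin by simp
    show False
    proof (cases "z \<in> Q")
      case True
      then have "card (Q - {a, z}) = 2"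
        using Q(3) ay(1) fin z(3) by (simp add: card_Diff_subset)
      then obtain c d where cd: "Q - {a, z} = {c, d}" "c \<noteq> d" by (metis card_2_iff)
      then have "c \<in> Q" "d \<in> Q" "c \<noteq> a" "d \<noteq> a" "c \<noteq> z" "d \<noteq> z" by blast+
      moreover from this have "E a c" "E c d" "E d z"
        using Q(2) ay(1) True cd(2) by (auto simp: is_clique_def)
      ultimately have "is_cycle M [y, a, c, d, z]"
        using ay z Q(1) yQ True cd(2) sym by (auto simp: is_cycle_def is_path_def)
      then show False using assms(3) by (auto simp: C5_free_def)
    next
      case False
      obtain b c d where bcd: "Q - {a} = {b, c, d}" "b \<noteq> c" "c \<noteq> d" "b \<noteq> d"
        using card3 by (metis card_3_iff)
      then have "b \<in> Q" "c \<in> Q" "d \<in> Q" "b \<noteq> a" "c \<noteq> a" "d \<noteq> a" by blast+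
      moreover from this have "E a b" "E b c" "E c d"
        using Q(2) ay(1) bcd(2-4) by (auto simp: is_clique_def)
      ultimately have "is_path M [z, y, a, b, c, d]"
        using ay z zy Q(1) yQ False bcd(2-4) sym by (auto simp: is_path_def)
      then show False using assms(2) by (auto simp: P6_free_def)
    qed
  qed
qed

text \<open>
  The weighted excess is at most that of the 2-core \<open>K\<close>, minus the weight outside \<open>K\<close>, and hence
  at most the excess of \<open>K\<close>. If \<open>K\<close> is empty, the whole weight is lost. Otherwise counting edges
  gives \<open>-3\<close>, provided that \<open>K\<close> contains no \<open>K\<^sub>4\<close>. A \<open>K\<^sub>4\<close> is a component of
  \<open>K\<close> of excess \<open>-2\<close>: if there are further vertices in \<open>K\<close>, these contribute another \<open>-2\<close>; if
  not, then \<open>K\<close> has weight at most 4, and weight at least 3 is lost outside.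
\<close>

lemma weighted_excess_extremal:
  assumes "finite M" "P6_free M" "C5_free M" and x: "\<And>v. v \<in> M \<Longrightarrow> x v \<in> {0..1}"
    and heavy: "sum x M \<ge> 7" and ge: "weighted_excess x M \<ge> -3"
  shows "weighted_excess x M = -3" "\<exists>K\<subseteq>M. sum x (M - K) = 0 \<and> (\<exists>a b. is_book a b K)"
proof -
  obtain K where K: "K \<subseteq> M" "\<And>v. v \<in> K \<Longrightarrow> deg K v \<ge> 2"
    and gK: "weighted_excess x M \<le> weighted_excess x K - sum x (M - K)"
    using two_core[OF assms(1), of x] x by blast
  have finK: "finite K" using K(1) assms(1) finite_subset by blast
  have free: "P6_free K" "C5_free K" using K(1) assms(2,3) P6_free_mono C5_free_mono by blast+
  have xK: "\<And>v. v \<in> K \<Longrightarrow> x v \<in> {0..1}" using x K(1) by blast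
  have rest: "sum x (M - K) \<ge> 0" using x by (intro sum_nonneg) auto
  have split: "sum x M = sum x K + sum x (M - K)"
    using sum.subset_diff[OF K(1) assms(1)] by (simp add: add.commute)
  have gK1: "weighted_excess x K \<le> excess K" using weighted_excess_le_excess[OF K(2) xK] .
  have "K \<noteq> {}" using split gK heavy ge by auto
  have K4: "K4_free K"
    unfolding K4_free_def
  proof (intro allI impI notI)
    fix Q assume Q: "Q \<subseteq> K" "is_clique Q" "card Q = 4"
    have cl: "closed_in K Q" using K4_closed[OF finK free K(2) Q] .
    have Q2: "excess Q \<le> -2" using excess_small[OF Q(3)] by simp
    show False
    proof (cases "Q = K")
      case True
      have "sum x K \<le> (\<Sum>v\<in>K. 1)" using xK by (intro sum_mono) auto
      then have "sum x K \<le> 4" using True Q(3) by simp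
      then show False using split gK gK1 Q2 True ge heavy by simp
    next
      case False
      have "excess (K - Q) \<le> -2"
        using False Q(1) finK free P6_free_mono[of K "K - Q"] C5_free_mono[of K "K - Q"]
        by (intro excess_le_minus2) auto
      then show False using weighted_excess_split[OF finK cl, of "\<lambda>_. 1"] Q2 gK gK1 ge rest by simp
    qed
  qed
  have "card K \<ge> 2"
  proof -
    obtain v where "v \<in> K" using \<open>K \<noteq> {}\<close> by blast
    then show ?thesis using deg_less_card[OF finK] K(2) by fastforce
  qed
  from excess_le_minus3[OF this free K4] excess_tight_book[OF this free K4]
  have le3: "excess K \<le> -3" and book: "excess K = -3 \<Longrightarrow> \<exists>a b. is_book a b K" by blast+
  show "weighted_excess x M = -3" using le3 gK gK1 ge rest by linarith
  have "excess K = -3" "sum x (M - K) = 0" using le3 gK gK1 ge rest by linarith+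
  then show "\<exists>K\<subseteq>M. sum x (M - K) = 0 \<and> (\<exists>a b. is_book a b K)"
    using book K(1) by blast
qed

section \<open>A subinvariant vector and the neighbourhood of its largest entry\<close>

lemma sum_nbrs_swap:
  assumes "finite A" "finite B"
  shows "(\<Sum>v\<in>A. \<Sum>w\<in>nbrs B v. f w) = (\<Sum>w\<in>B. real (deg A w) * f w)"
proof -
  have "(\<Sum>v\<in>A. \<Sum>w\<in>nbrs B v. f w) = (\<Sum>w\<in>B. \<Sum>v\<in>{v\<in>A. E v w}. f w)"
    unfolding nbrs_def using assms by (rule sum.swap_restrict)
  also have "\<dots> = (\<Sum>w\<in>B. real (deg A w) * f w)"
    unfolding deg_def nbrs_def using sym_iff by simp
  finally show ?thesis .
qed

lemma sum_deg_swap: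
  assumes "finite A" "finite B"
  shows "(\<Sum>v\<in>A. real (deg B v)) = (\<Sum>w\<in>B. real (deg A w))"
  using sum_nbrs_swap[OF assms, of "\<lambda>_. 1"] by (simp add: deg_def)

lemma C5_rotate: "is_cycle M [a,b,c,d,e] \<Longrightarrow> is_cycle M [b,c,d,e,a]"
  by (auto simp: is_cycle_def is_path_def)

lemma C5_starting_at:
  assumes "is_cycle M xs" "length xs = 5" "h \<in> set xs"
  obtains b c d e where "is_cycle M [h,b,c,d,e]" "set xs = {h,b,c,d,e}"
proof -
  obtain a b c d e where xs: "xs = [a,b,c,d,e]"
    using assms(2) by (auto simp: numeral_eq_Suc length_Suc_conv)
  have 1: "is_cycle M [a,b,c,d,e]" using assms(1) xs by simp
  note 2 = C5_rotate[OF 1] note 3 = C5_rotate[OF 2]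
  note 4 = C5_rotate[OF 3] note 5 = C5_rotate[OF 4]
  from assms(3) xs consider "h = a" | "h = b" | "h = c" | "h = d" | "h = e" by auto
  then show ?thesis
  proof cases
    case 1 with \<open>is_cycle M [a,b,c,d,e]\<close> show ?thesis using xs that[of b c d e] by simp
  next
    case 2 with \<open>is_cycle M [b,c,d,e,a]\<close> show ?thesis using xs that[of c d e a] by auto
  next
    case 3 with \<open>is_cycle M [c,d,e,a,b]\<close> show ?thesis using xs that[of d e a b] by auto
  next
    case 4 with \<open>is_cycle M [d,e,a,b,c]\<close> show ?thesis using xs that[of e a b c] by auto
  next
    case 5 with \<open>is_cycle M [e,a,b,c,d]\<close> show ?thesis using xs that[of a b c d] by auto
  qed
qed

lemma C5_degrees:
  assumes "is_cycle M xs" "length xs = 5" "v \<in> set xs"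
  shows "2 \<le> deg (set xs) v" "deg (set xs) v \<le> 4"
proof -
  obtain b c d e where c: "is_cycle M [v,b,c,d,e]" and eq: "set xs = {v,b,c,d,e}"
    using C5_starting_at[OF assms] .
  have dist: "v \<noteq> b" "b \<noteq> e" "v \<noteq> e" and E: "E v b" "E v e"
    using c sym by (auto simp: is_cycle_def is_path_def)
  have "{b, e} \<subseteq> nbrs (set xs) v" using E eq by (auto simp: nbrs_def)
  from card_mono[OF _ this] show "2 \<le> deg (set xs) v" using dist by (simp add: deg_def)
  have "deg (set xs) v < card (set xs)" using deg_less_card[OF _ assms(3)] by simp
  then show "deg (set xs) v \<le> 4" using card_length[of xs] assms(2) by simp
qed

end

text \<open>
  The vector \<open>x\<close> satisfies \<open>\<lambda>x \<le> Ax\<close> for the adjacency matrix \<open>A\<close> and takes its maximum 1 at \<open>u\<close>. An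
  inequality is enough: where equality fails, the bound derived from it only becomes stronger.
  Absolute values of an eigenvector are therefore admissible, without any
  appeal to Perron--Frobenius theory.
\<close>

locale subinvariant = adjacency E for E :: "'a \<Rightarrow> 'a \<Rightarrow> bool" +
  fixes V :: "'a set" and x :: "'a \<Rightarrow> real" and lam :: real and u :: 'a
  assumes finV: "finite V" and EV: "E v w \<Longrightarrow> v \<in> V"
    and uV: "u \<in> V" and xu: "x u = 1" and x01: "v \<in> V \<Longrightarrow> x v \<in> {0..1}"
    and sub: "v \<in> V \<Longrightarrow> lam * x v \<le> sum x (nbrs V v)"
    and lam7: "lam \<ge> 7"
begin

abbreviation N :: "'a set" where "N \<equiv> nbrs V u"

definition W :: "'a set" where "W = V - insert u N"

lemma vertex_partition:
  "finite N" "finite W" "N \<subseteq> V" "W \<subseteq> V" "u \<notin> N" "u \<notin> W" "N \<inter> W = {}" "V = insert u (N \<union> W)"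
  using finV irrefl uV by (auto simp: W_def nbrs_def)

lemma x_range: "v \<in> N \<Longrightarrow> x v \<in> {0..1}" "v \<in> W \<Longrightarrow> x v \<in> {0..1}"
  using x01 vertex_partition by blast+

lemma nbrs_N:
  assumes "v \<in> N"
  shows "sum f (nbrs V v) = f u + sum f (nbrs N v) + (sum f (nbrs W v) :: real)"
proof -
  have "nbrs V v = insert u (nbrs N v \<union> nbrs W v)"
    using assms vertex_partition(8) sym by (auto simp: nbrs_def)
  moreover have "u \<notin> nbrs N v \<union> nbrs W v" "nbrs N v \<inter> nbrs W v = {}"
    using vertex_partition nbrs_subset by blast+
  ultimately show ?thesis using vertex_partition by (simp add: sum.union_disjoint)
qed

lemma nbrs_W:
  assumes "w \<in> W"
  shows "sum f (nbrs V w) = sum f (nbrs N w) + (sum f (nbrs W w) :: real)"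
proof -
  have "nbrs V w = nbrs N w \<union> nbrs W w"
    using assms vertex_partition(8) sym EV by (auto simp: nbrs_def W_def)
  moreover have "nbrs N w \<inter> nbrs W w = {}"
    using vertex_partition nbrs_subset by blast
  ultimately show ?thesis using vertex_partition by (simp add: sum.union_disjoint)
qed

lemma deg_N: "v \<in> N \<Longrightarrow> real (deg V v) = 1 + real (deg N v) + real (deg W v)"
  using nbrs_N[of v "\<lambda>_. 1"] by (simp add: deg_def)

lemma deg_W: "w \<in> W \<Longrightarrow> real (deg V w) = real (deg N w) + real (deg W w)"
  using nbrs_W[of w "\<lambda>_. 1"] by (simp add: deg_def)

lemma sum_V: "sum f V = f u + sum f N + (sum f W :: real)"
proof -
  have "sum f V = sum f (insert u (N \<union> W))" using vertex_partition(8) by simp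
  also have "\<dots> = f u + sum f (N \<union> W)" using vertex_partition by (intro sum.insert) auto
  also have "sum f (N \<union> W) = sum f N + sum f W" using vertex_partition by (intro sum.union_disjoint) auto
  finally show ?thesis by simp
qed

text \<open>
  Summing \<open>\<lambda>x\<^sub>v \<le> (Ax)\<^sub>v\<close> over the neighbours \<open>v\<close> of \<open>u\<close> counts walks of length 2 from \<open>u\<close>. By
  assumption \<open>(\<lambda> - 2)\<lambda> \<ge> m - 3\<close>, and \<open>\<lambda>\<close> is at most the total weight of the neighbourhood \<open>N\<close>. Writing
  \<open>m\<close> as the number of edges at \<open>u\<close>, inside \<open>N\<close>, between \<open>N\<close> and \<open>W\<close>, and inside \<open>W\<close> turns this into
  a lower bound for the weighted excess of \<open>N\<close>. All losses are kept as separate nonnegative terms,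
  since every one of them has to vanish in the extremal case.
\<close>

lemma neighbourhood_inequality:
  assumes m: "2 * real m = (\<Sum>v\<in>V. real (deg V v))" and lam: "real m - 3 \<le> lam\<^sup>2 - 2 * lam"
  shows "-3 + (\<Sum>w\<in>W. real (deg W w)) / 2 + (\<Sum>w\<in>W. real (deg N w) * (1 - x w))
      + (lam - 2) * (sum x N - lam) + (\<Sum>v\<in>N. sum x (nbrs V v) - lam * x v) \<le> weighted_excess x N"
proof -
  have "2 * real m = real (deg V u) + (\<Sum>v\<in>N. 1 + real (deg N v) + real (deg W v))
      + (\<Sum>w\<in>W. real (deg N w) + real (deg W w))"
    unfolding m sum_V using deg_N deg_W by simp
  then have m2: "2 * real m = 2 * real (card N) + (\<Sum>v\<in>N. real (deg N v))
      + 2 * (\<Sum>w\<in>W. real (deg N w)) + (\<Sum>w\<in>W. real (deg W w))"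
    using sum_deg_swap[OF vertex_partition(1,2)] by (simp add: sum.distrib deg_def[of V u])
  have "(\<Sum>v\<in>N. sum x (nbrs V v)) = (\<Sum>v\<in>N. x u + sum x (nbrs N v) + sum x (nbrs W v))"
    by (intro sum.cong refl nbrs_N)
  also have "\<dots> = real (card N) + (\<Sum>v\<in>N. real (deg N v) * x v) + (\<Sum>w\<in>W. real (deg N w) * x w)"
    using sum_nbrs_swap[OF vertex_partition(1,1), of x] sum_nbrs_swap[OF vertex_partition(1,2), of x] xu
    by (simp add: sum.distrib)
  finally have "(\<Sum>v\<in>N. sum x (nbrs V v) - lam * x v) = real (card N)
      + (\<Sum>v\<in>N. real (deg N v) * x v) + (\<Sum>w\<in>W. real (deg N w) * x w) - lam * sum x N"
    by (simp add: sum_subtractf sum_distrib_left)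
  moreover have "weighted_excess x N = (\<Sum>v\<in>N. real (deg N v) * x v) - (\<Sum>v\<in>N. real (deg N v)) / 2 - 2 * sum x N"
    unfolding weighted_excess_def by (simp add: sum_subtractf right_diff_distrib sum_distrib_left sum_divide_distrib)
  moreover have "(\<Sum>w\<in>W. real (deg N w) * (1 - x w))
      = (\<Sum>w\<in>W. real (deg N w)) - (\<Sum>w\<in>W. real (deg N w) * x w)"
    by (simp add: right_diff_distrib sum_subtractf)
  ultimately show ?thesis
    using m2 lam by (simp add: algebra_simps power2_eq_square)
qed

lemma weight_N_ge: "sum x N \<ge> lam"
  using sub[OF uV] xu by simp

lemma slack_terms_nonneg:
  "0 \<le> (\<Sum>w\<in>W. real (deg W w))" "0 \<le> (\<Sum>w\<in>W. real (deg N w) * (1 - x w))"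
  "0 \<le> (lam - 2) * (sum x N - lam)" "0 \<le> (\<Sum>v\<in>N. sum x (nbrs V v) - lam * x v)"
proof -
  show "0 \<le> (\<Sum>w\<in>W. real (deg W w))" by (simp add: sum_nonneg)
  show "0 \<le> (\<Sum>w\<in>W. real (deg N w) * (1 - x w))" using x_range by (intro sum_nonneg) auto
  show "0 \<le> (lam - 2) * (sum x N - lam)" using weight_N_ge lam7 by simp
  show "0 \<le> (\<Sum>v\<in>N. sum x (nbrs V v) - lam * x v)"
    using sub vertex_partition by (intro sum_nonneg) auto
qed

lemma cycle_through_u:
  assumes "is_path N xs" "xs \<noteq> []"
  shows "is_cycle V (u # xs)"
proof -
  have "hd xs \<in> N" "last xs \<in> N" using assms by (auto simp: is_path_def)
  then have "E u (hd xs)" "E (last xs) u" using sym by (auto simp: nbrs_def)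
  then show ?thesis
    using assms vertex_partition uV by (cases xs) (auto simp: is_cycle_def is_path_def)
qed

text \<open>
  A path on \<open>i - 1\<close> vertices in the neighbourhood of \<open>u\<close> closes up through \<open>u\<close> to a cycle of length
  \<open>i\<close>.
\<close>

lemma P6_free_N:
  assumes "i \<in> {3..7}" and missing: "\<And>xs. is_cycle V xs \<Longrightarrow> length xs \<noteq> i"
  shows "P6_free N"
  unfolding P6_free_def
proof (intro allI impI)
  fix xs assume xs: "is_path N xs"
  show "length xs \<le> 5"
  proof (rule ccontr)
    assume long: "\<not> length xs \<le> 5"
    let ?ys = "take (i - 1) xs"
    have "xs = ?ys @ drop (i - 1) xs" by simp
    then have "successively E ?ys"
      using xs unfolding is_path_def by (metis successively_append_iff)
    then have "is_path N ?ys" using xs set_take_subset[of "i - 1" xs] by (auto simp: is_path_def)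
    moreover have "length ?ys = i - 1" using long assms(1) by (auto simp: min_def)
    ultimately have "is_cycle V (u # ?ys)" "length (u # ?ys) = i"
      using assms(1) by (auto intro!: cycle_through_u)
    then show False using missing by blast
  qed
qed

text \<open>
  A 5-cycle in \<open>N\<close> spans a wheel with centre \<open>u\<close>, which has cycles of the lengths 3 to 6. So the
  missing length is 7, and a vertex \<open>w\<close> of \<open>W\<close> with a neighbour \<open>h\<close> on the rim cannot have another
  neighbour \<open>z\<close> in \<open>N\<close>: some path on six vertices from \<open>h\<close> to \<open>z\<close> inside \<open>N \<union> {u}\<close> would close up
  through \<open>w\<close>.
\<close>

lemma C5_outside_degree:
  assumes i: "i \<in> {3..7}" and missing: "\<And>xs. is_cycle V xs \<Longrightarrow> length xs \<noteq> i"
    and c: "is_cycle N xs" "length xs = 5" and w: "w \<in> W" and h: "h \<in> set xs" "E w h"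
  shows "nbrs N w = {h}"
proof -
  obtain b c d e where cyc: "is_cycle N [h,b,c,d,e]" and eq: "set xs = {h,b,c,d,e}"
    using C5_starting_at[OF c h(1)] .
  let ?H = "{h,b,c,d,e}"
  have dist: "distinct [h,b,c,d,e]" and inN: "?H \<subseteq> N"
    and cE: "E h b" "E b c" "E c d" "E d e" "E e h"
    using cyc by (auto simp: is_cycle_def is_path_def)
  have uE: "\<And>y. y \<in> N \<Longrightarrow> E u y \<and> E y u" using sym unfolding nbrs_def by blast
  have "\<forall>y\<in>?H. E u y \<and> E y u" using inN uE by blast
  then have spokes: "E u h" "E u b" "E u c" "E u d" "E u e" "E h u" "E b u" "E c u" "E d u" "E e u"
    by simp_all
  have rev: "E b h" "E c b" "E d c" "E e d" "E h e" using cE sym by auto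
  have wuH: "distinct [w,u,h,b,c,d,e]" using dist w inN vertex_partition by auto
  have V: "set [w,u,h,b,c,d,e] \<subseteq> V" using uV w inN vertex_partition by auto
  have "is_cycle V [u,h,b]" "is_cycle V [u,h,b,c]" "is_cycle V [u,h,b,c,d]"
    "is_cycle V [u,h,b,c,d,e]"
    using wuH cE spokes V by (simp_all add: is_cycle_def is_path_def)
  from this[THEN missing] have i7: "i = 7" using i by auto
  have no7: "\<not> is_cycle V [x1,x2,x3,x4,x5,x6,x7]" for x1 x2 x3 x4 x5 x6 x7
    using missing[of "[x1,x2,x3,x4,x5,x6,x7]"] i7 by auto
  have "z = h" if z: "z \<in> nbrs N w" for z
  proof (rule ccontr)
    assume zh: "z \<noteq> h"
    have zN: "z \<in> N" "z \<in> V" and wz: "E z w" "E w h"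
      using z h(2) sym vertex_partition by (auto simp: nbrs_def)
    have uz: "E u z" using uE zN(1) by blast
    consider "z = b" | "z = c" | "z = d" | "z \<notin> {b, c, d}" by blast
    then have "\<exists>x1 x2 x3 x4 x5 x6 x7. is_cycle V [x1,x2,x3,x4,x5,x6,x7]"
    proof cases
      case 1
      have "is_cycle V [w,h,e,d,c,u,b]"
        using 1 wuH V cE rev spokes wz by (auto simp: is_cycle_def is_path_def)
      then show ?thesis by blast
    next
      case 2
      have "is_cycle V [w,h,b,u,e,d,c]"
        using 2 wuH V cE rev spokes wz by (auto simp: is_cycle_def is_path_def)
      then show ?thesis by blast
    next
      case 3
      have "is_cycle V [w,h,e,u,b,c,d]"
        using 3 wuH V cE rev spokes wz by (auto simp: is_cycle_def is_path_def)
      then show ?thesis by blast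
    next
      case 4
      have "z \<noteq> w" "z \<noteq> u" using zN w vertex_partition by auto
      then have "is_cycle V [w,h,b,c,d,u,z]"
        using 4 zh zN(2) wuH V cE spokes wz uz by (auto simp: is_cycle_def is_path_def)
      then show ?thesis by blast
    qed
    then show False using no7 by blast
  qed
  moreover have "h \<in> nbrs N w" using h inN by (auto simp: nbrs_def)
  ultimately show ?thesis by blast
qed

text \<open>
  A component of \<open>N\<close> on five vertices may have as much as twice as many edges as vertices, so edge
  counting cannot rule it out; but its weight \<open>s\<close> is too small. Let \<open>p\<close> be the number of edges from
  the 5-cycle \<open>H\<close> to \<open>W\<close>, let \<open>S\<close> be the total weight of their ends in \<open>W\<close>, and let \<open>eW\<close> be twice the
  number of edges inside \<open>W\<close>. Summing \<open>\<lambda>x \<le> Ax\<close> over \<open>H\<close> gives \<open>(\<lambda> - 4) s \<le> 5 + S\<close>. Summing it over the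
  ends in \<open>W\<close>, which have only one neighbour in \<open>N\<close>, gives \<open>\<lambda>S \<le> p + eW\<close>. The weighted excess of
  \<open>N\<close> is at most \<open>s - 5\<close>, and at least \<open>-3 + eW/2 + p - S\<close>. These inequalities contradict each other
  when \<open>\<lambda> \<ge> 7\<close>.
\<close>

lemma C5_free_N:
  assumes m: "2 * real m = (\<Sum>v\<in>V. real (deg V v))" and lam: "real m - 3 \<le> lam\<^sup>2 - 2 * lam"
    and i: "i \<in> {3..7}" and missing: "\<And>xs. is_cycle V xs \<Longrightarrow> length xs \<noteq> i"
  shows "C5_free N"
  unfolding C5_free_def
proof (intro allI impI notI)
  fix xs assume c: "is_cycle N xs" "length xs = 5"
  define H where "H = set xs"
  have P6: "P6_free N" using P6_free_N[OF i missing] .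
  have H: "H \<subseteq> N" "card H = 5" "finite H"
    using c by (auto simp: H_def is_cycle_def is_path_def distinct_card)
  have closed: "closed_in N H" using C5_closed[OF P6 c] by (simp add: H_def)
  have dH: "2 \<le> deg H v" "deg H v \<le> 4" if "v \<in> H" for v
    using C5_degrees[OF c, of v] that by (simp_all add: H_def)
  have xH: "x v \<in> {0..1}" if "v \<in> H" for v using that H x_range by blast
  define s S p eW where "s = sum x H" and "S = (\<Sum>w\<in>W. real (deg H w) * x w)"
    and "p = (\<Sum>w\<in>W. real (deg H w))" and "eW = (\<Sum>w\<in>W. real (deg W w))"
  have p0: "p \<ge> 0" "eW \<ge> 0" by (auto simp: p_def eW_def intro: sum_nonneg)
  (* A vertex of degree d contributes at most 2 * x v - d/2, since d <= 4, and at most d/2 - 2, since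
     x v <= 1 and d >= 2. The mean of these bounds is x v - 1, independently of the chords of H. *)
  have "weighted_excess x H \<le> (\<Sum>v\<in>H. x v - 1)"
    unfolding weighted_excess_def
  proof (rule sum_mono)
    fix v assume v: "v \<in> H"
    consider "deg H v = 2" | "deg H v = 3" | "deg H v = 4" using dH[OF v] by linarith
    then show "real (deg H v) * (x v - 1/2) - 2 * x v \<le> x v - 1"
      using xH[OF v] by cases auto
  qed
  also have "\<dots> = s - 5" using H by (simp add: sum_subtractf s_def)
  finally have gH: "weighted_excess x H \<le> s - 5" .
  have "weighted_excess x (N - H) \<le> 0"
    using P6_free_mono[OF P6] vertex_partition(1) x_range by (intro weighted_excess_nonpos) auto
  then have gN: "weighted_excess x N \<le> s - 5" using weighted_excess_split[OF vertex_partition(1) closed, of x] gH by simp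
  have outside: "real (deg H w) \<le> 1 \<and> real (deg H w) \<le> real (deg N w)
      \<and> (deg H w = 0 \<or> lam * x w \<le> 1 + real (deg W w))" if w: "w \<in> W" for w
  proof (cases "\<exists>h\<in>H. E w h")
    case True
    then obtain h where h: "h \<in> H" "E w h" by blast
    have Nw: "nbrs N w = {h}" using C5_outside_degree[OF i missing c w] h by (simp add: H_def)
    then have "nbrs H w = {h}" using h H(1) by (auto simp: nbrs_def)
    moreover have "lam * x w \<le> sum x (nbrs N w) + sum x (nbrs W w)"
      using sub[of w] nbrs_W[OF w, of x] w vertex_partition by auto
    moreover have "sum x (nbrs N w) \<le> 1" using Nw xH h by simp
    moreover have "sum x (nbrs W w) \<le> (\<Sum>z\<in>nbrs W w. 1)"
      using x_range nbrs_subset by (intro sum_mono) fastforce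
    ultimately show ?thesis using Nw by (simp add: deg_def)
  next
    case False
    then have "nbrs H w = {}" by (auto simp: nbrs_def)
    then show ?thesis by (simp add: deg_def)
  qed
  have "p - S = (\<Sum>w\<in>W. real (deg H w) * (1 - x w))"
    by (simp add: p_def S_def right_diff_distrib sum_subtractf)
  also have "\<dots> \<le> (\<Sum>w\<in>W. real (deg N w) * (1 - x w))"
    using outside x_range by (intro sum_mono mult_right_mono) auto
  finally have pS: "p - S \<le> (\<Sum>w\<in>W. real (deg N w) * (1 - x w))" .
  have "lam * S = (\<Sum>w\<in>W. real (deg H w) * (lam * x w))"
    by (simp add: S_def sum_distrib_left mult_ac)
  also have "\<dots> \<le> (\<Sum>w\<in>W. real (deg H w) + real (deg W w))"
  proof (rule sum_mono)
    fix w assume w: "w \<in> W"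
    show "real (deg H w) * (lam * x w) \<le> real (deg H w) + real (deg W w)"
    proof (cases "deg H w = 0")
      case False
      then have "deg H w = 1" "lam * x w \<le> 1 + real (deg W w)" using outside[OF w] by auto
      then show ?thesis by simp
    qed simp
  qed
  also have "\<dots> = p + eW" by (simp add: p_def eW_def sum.distrib)
  finally have lS: "lam * S \<le> p + eW" .
  have S0: "S \<ge> 0" using x_range by (auto simp: S_def intro!: sum_nonneg)
  have s0: "s \<ge> 0" using xH by (auto simp: s_def intro!: sum_nonneg)
  have "lam * s = (\<Sum>v\<in>H. lam * x v)" by (simp add: s_def sum_distrib_left)
  also have "\<dots> \<le> (\<Sum>v\<in>H. 1 + sum x (nbrs H v) + sum x (nbrs W v))"
  proof (rule sum_mono)
    fix v assume v: "v \<in> H"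
    then have vN: "v \<in> N" using H by blast
    have "nbrs N v = nbrs H v"
      using closed v by (auto simp: closed_in_def nbrs_def)
    then show "lam * x v \<le> 1 + sum x (nbrs H v) + sum x (nbrs W v)"
      using sub[of v] nbrs_N[OF vN, of x] xu vN vertex_partition by auto
  qed
  also have "\<dots> = 5 + (\<Sum>v\<in>H. real (deg H v) * x v) + S"
    using sum_nbrs_swap[OF H(3,3), of x] sum_nbrs_swap[OF H(3) vertex_partition(2), of x] H(2)
    by (simp add: sum.distrib S_def)
  also have "(\<Sum>v\<in>H. real (deg H v) * x v) \<le> (\<Sum>v\<in>H. 4 * x v)"
    using dH xH by (intro sum_mono mult_right_mono) auto
  also have "\<dots> = 4 * s" by (simp add: s_def sum_distrib_left)
  finally have ls: "lam * s \<le> 5 + 4 * s + S" by simp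
  have "7 * s \<le> lam * s" "7 * S \<le> lam * S" using lam7 s0 S0 by (auto intro: mult_right_mono)
  moreover have "-3 + eW / 2 + (p - S) \<le> s - 5"
    using neighbourhood_inequality[OF m lam] slack_terms_nonneg(3,4) gN pS
    unfolding eW_def by linarith
  ultimately show False using ls lS p0 by linarith
qed

text \<open>
  The lower bound \<open>-3\<close> for the weighted excess of \<open>N\<close> meets the upper bound, so all losses vanish. In
  particular \<open>x\<close> is positive on \<open>N\<close>, so nothing was deleted on the way to the 2-core and \<open>N\<close> is a book.
  There are no edges inside \<open>W\<close>, and a vertex \<open>w\<close> of \<open>W\<close> has weight 1; as \<open>\<lambda>\<close> is the total weight of
  \<open>N\<close>, it is adjacent to all of \<open>N\<close>. But then hubs, pages, \<open>u\<close> and \<open>w\<close> provide cycles of all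
  lengths from 3 to 7.
\<close>

theorem neighbourhood_is_book:
  assumes m: "2 * real m = (\<Sum>v\<in>V. real (deg V v))" and lam: "real m - 3 \<le> lam\<^sup>2 - 2 * lam"
    and i: "i \<in> {3..7}" and missing: "\<And>xs. is_cycle V xs \<Longrightarrow> length xs \<noteq> i"
    and noniso: "\<And>v. v \<in> V \<Longrightarrow> \<exists>w. E v w"
  shows "W = {}" "\<exists>a b. is_book a b N"
proof -
  have P6: "P6_free N" using P6_free_N[OF i missing] .
  have C5: "C5_free N" using C5_free_N[OF m lam i missing] .
  note ineq = neighbourhood_inequality[OF m lam] slack_terms_nonneg
  have ge: "weighted_excess x N \<ge> -3" using ineq by linarith
  have heavy7: "sum x N \<ge> 7" using weight_N_ge lam7 by simp
  note ext = weighted_excess_extremal[OF vertex_partition(1) P6 C5 x_range(1) heavy7 ge]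
  have zeros: "(\<Sum>w\<in>W. real (deg W w)) = 0" "(\<Sum>w\<in>W. real (deg N w) * (1 - x w)) = 0"
      "(lam - 2) * (sum x N - lam) = 0" "(\<Sum>v\<in>N. sum x (nbrs V v) - lam * x v) = 0"
    using ineq ext(1) by linarith+
  have tot: "sum x N = lam" using zeros(3) lam7 by simp
  have pos: "x v > 0" if v: "v \<in> N" for v
  proof -
    have "\<forall>v\<in>N. sum x (nbrs V v) - lam * x v = 0"
      using zeros(4) vertex_partition sub by (subst (asm) sum_nonneg_eq_0_iff) auto
    then have "lam * x v = sum x (nbrs V v)" using v by simp
    also have "\<dots> \<ge> sum x {u}"
      using v sym finV x01 uV by (intro sum_mono2) (auto simp: nbrs_def)
    finally show "x v > 0" using xu lam7 by (smt (verit) mult_nonneg_nonpos sum.insert sum.empty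
      finite.emptyI empty_iff)
  qed
  obtain K a b where K: "K \<subseteq> N" "sum x (N - K) = 0" "is_book a b K" using ext(2) by blast
  have "\<forall>v\<in>N - K. x v = 0"
    using K(2) vertex_partition pos by (subst (asm) sum_nonneg_eq_0_iff) (auto intro: less_imp_le)
  then have "N - K = {}" using pos by force
  then have "K = N" using K(1) by blast
  with K(3) have book: "is_book a b N" by simp
  then show "\<exists>a b. is_book a b N" by blast
  show "W = {}"
  proof (rule ccontr)
    assume "W \<noteq> {}"
    then obtain w where w: "w \<in> W" by blast
    have "deg W w = 0" using zeros(1) w vertex_partition by (subst (asm) sum_nonneg_eq_0_iff) auto
    then have nW: "nbrs W w = {}" using vertex_partition by (simp add: deg_def)
    obtain z where "E w z" using noniso w vertex_partition by blast
    then have "z \<in> nbrs V w" using EV sym by (auto simp: nbrs_def)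
    then have "deg V w \<noteq> 0" using finV by (auto simp: deg_def)
    then have "deg N w \<noteq> 0" using deg_W[OF w] \<open>deg W w = 0\<close> by simp
    moreover have "real (deg N w) * (1 - x w) = 0"
      using zeros(2) w vertex_partition x_range by (subst (asm) sum_nonneg_eq_0_iff) auto
    ultimately have "x w = 1" by simp
    then have "lam \<le> sum x (nbrs N w)"
      using sub[of w] nbrs_W[OF w, of x] nW w vertex_partition by auto
    moreover have "sum x N = sum x (nbrs N w) + sum x (N - nbrs N w)"
      using sum.subset_diff[OF nbrs_subset vertex_partition(1), where g = x] by (simp add: add.commute)
    moreover have "sum x (N - nbrs N w) \<ge> 0" using x_range by (intro sum_nonneg) auto
    ultimately have "sum x (N - nbrs N w) = 0" using tot by linarith
    then have "\<forall>v\<in>N - nbrs N w. x v = 0"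
      using vertex_partition pos by (subst (asm) sum_nonneg_eq_0_iff) (auto intro: less_imp_le)
    then have "N - nbrs N w = {}" using pos by force
    then have wE: "E w y" "E y w" if "y \<in> N" for y using that sym by (auto simp: nbrs_def)
    have uE: "E u y" "E y u" if "y \<in> N" for y using that sym by (auto simp: nbrs_def)
    have "sum x N \<le> (\<Sum>v\<in>N. 1)" using x_range by (intro sum_mono) auto
    then have "card N \<ge> 7" using heavy7 by simp
    then have "card (N - {a, b}) \<ge> 3" using book_hubs[OF book] vertex_partition by (simp add: card_Diff_subset)
    then obtain T where "T \<subseteq> N - {a, b}" "card T = 3" using obtain_subset_with_card_n by metis
    then obtain c d e where pages: "c \<in> N - {a, b}" "d \<in> N - {a, b}" "e \<in> N - {a, b}"
      and ne: "c \<noteq> d" "c \<noteq> e" "d \<noteq> e" by (auto simp: card_3_iff)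
    note facts = book_hubs[OF book] book_page[OF book pages(1)] book_page[OF book pages(2)]
      book_page[OF book pages(3)]
    have inN: "{a,b,c,d,e} \<subseteq> N" using facts by blast
    then have V: "{w,u,a,b,c,d,e} \<subseteq> V" using w uV vertex_partition by blast
    have dist: "distinct [w,u,a,b,c,d,e]" using facts ne inN w vertex_partition by auto
    have "\<forall>y\<in>{a,b,c,d,e}. E u y \<and> E y u \<and> E w y \<and> E y w" using uE wE inN by (meson subsetD)
    then have spokes: "E u a" "E u c" "E a u" "E b u" "E e u" "E d w" "E w e" by simp_all
    have "E a b" "E a c" "E c b" "E c a" "E a d" "E d b" "E b d" "E b e" using facts by blast+
    with spokes V dist have "is_cycle V [u,a,b]" "is_cycle V [u,a,c,b]" "is_cycle V [u,c,a,d,b]"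
      "is_cycle V [u,c,a,d,b,e]" "is_cycle V [u,c,a,b,d,w,e]"
      by (auto simp: is_cycle_def is_path_def)
    from this[THEN missing] i show False by auto
  qed
qed

end

section \<open>From pair graphs to adjacency relations\<close>

lemma cas_zip:
  assumes "ys \<noteq> []"
  shows "pre_digraph.cas (with_proj G) (hd ys) (zip ys (tl ys)) (last ys)"
    and "pre_digraph.awalk_verts (with_proj G) (hd ys) (zip ys (tl ys)) = ys"
  using assms
  by (induction ys rule: induct_list012)
     (simp_all add: pre_digraph.cas.simps pre_digraph.awalk_verts.simps)

lemma set_zip_successively:
  "set (zip ys (tl ys)) \<subseteq> R \<longleftrightarrow> successively (\<lambda>v w. (v, w) \<in> R) ys"
  by (induction ys rule: induct_list012) auto

lemma adjacency_parcs:
  assumes "pair_graph G"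
  shows "adjacency (\<lambda>v w. (v, w) \<in> parcs G)"
proof -
  interpret pair_graph G by fact
  show ?thesis by unfold_locales (auto intro: arcs_symmetric dest: no_loops')
qed

text \<open>
  The arcs of the closed walk are the consecutive pairs of the list with its head repeated at the
  end.
\<close>

lemma contains_cycleI:
  assumes "pair_graph G" and c: "adjacency.is_cycle (\<lambda>v w. (v, w) \<in> parcs G) (pverts G) xs"
    and "xs \<noteq> []"
  shows "contains_cycle G (length xs)"
proof -
  interpret pair_graph G by fact
  interpret adj: adjacency "\<lambda>v w. (v, w) \<in> parcs G" by (rule adjacency_parcs) fact
  define ys where "ys = xs @ [hd xs]"
  have ys: "ys \<noteq> []" "hd ys = hd xs" "last ys = hd xs" "tl ys = tl xs @ [hd xs]"
    using assms(3) by (simp_all add: ys_def)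
  let ?p = "zip ys (tl ys)"
  have c': "distinct xs" "set xs \<subseteq> pverts G" "successively (\<lambda>v w. (v, w) \<in> parcs G) xs"
    "(last xs, hd xs) \<in> parcs G"
    using c by (simp_all add: adj.is_cycle_def adj.is_path_def)
  have "successively (\<lambda>v w. (v, w) \<in> parcs G) ys"
    using c' assms(3) by (simp add: ys_def successively_append_iff)
  then have "set ?p \<subseteq> parcs G" by (simp add: set_zip_successively)
  moreover have "hd xs \<in> pverts G" using c'(2) assms(3) by auto
  ultimately have "awalk (hd xs) ?p (hd xs)"
    using cas_zip(1)[OF ys(1), of G] ys by (simp add: awalk_def)
  moreover have "distinct (tl (awalk_verts (hd xs) ?p))"
    using cas_zip(2)[OF ys(1), of G] ys c'(1) assms(3) by (cases xs) auto
  moreover have len: "length ?p = length xs" using assms(3) by (simp add: ys_def)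
  moreover have "?p \<noteq> []" using len assms(3) by (metis length_0_conv)
  ultimately show ?thesis unfolding contains_cycle_def cycle_def by blast
qed

lemma sum_degrees:
  assumes "pair_graph G"
  shows "(\<Sum>v\<in>pverts G. real (adjacency.deg (\<lambda>v w. (v, w) \<in> parcs G) (pverts G) v))
    = 2 * real (card (edges G))"
proof -
  interpret pair_graph G by fact
  interpret adj: adjacency "\<lambda>v w. (v, w) \<in> parcs G" by (rule adjacency_parcs) fact
  let ?f = "\<lambda>(u, v). {u, v}"
  have "card {a \<in> parcs G. ?f a = e} = 2" if e: "e \<in> edges G" for e
  proof -
    obtain u v where uv: "(u, v) \<in> parcs G" "e = {u, v}" using e by (auto simp: edges_def)
    then have "{a \<in> parcs G. ?f a = e} = {(u, v), (v, u)}"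
      using arcs_symmetric by (auto simp: doubleton_eq_iff)
    moreover have "u \<noteq> v" using uv no_loops' by blast
    ultimately show ?thesis by simp
  qed
  then have "card (parcs G) = 2 * card (edges G)"
    using sum.image_gen[of "parcs G" "\<lambda>_. 1::nat" ?f] by (simp add: edges_def)
  moreover have "card (parcs G) = (\<Sum>v\<in>pverts G. adj.deg (pverts G) v)"
  proof -
    have "parcs G = (SIGMA v:pverts G. adj.nbrs (pverts G) v)"
      using wellformed' by (auto simp: adj.nbrs_def)
    then have "card (parcs G) = card (SIGMA v:pverts G. adj.nbrs (pverts G) v)"
      by (rule arg_cong)
    then show ?thesis by (simp add: adj.deg_def)
  qed
  ultimately show ?thesis by (metis of_nat_mult of_nat_numeral of_nat_sum)
qed

text \<open>
  Take an eigenvalue of largest modulus and a complex eigenvector for it. By the triangle inequality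
  the moduli of its entries satisfy \<open>\<rho>|f| \<le> A|f|\<close>; scale the largest one to 1.
\<close>

lemma spectral_radius_subinvariant:
  assumes "pair_graph G" "pverts G \<noteq> {}"
  shows "\<exists>u\<in>pverts G. \<exists>x. x u = (1::real) \<and> (\<forall>v\<in>pverts G. x v \<in> {0..1} \<and>
    graph_spectral_radius G * x v
      \<le> sum x (adjacency.nbrs (\<lambda>v w. (v, w) \<in> parcs G) (pverts G) v))"
proof -
  interpret pair_graph G by fact
  interpret adj: adjacency "\<lambda>v w. (v, w) \<in> parcs G" by (rule adjacency_parcs) fact
  obtain vs where vs: "set vs = pverts G" "distinct vs"
    using finite_distinct_list pair_finite_verts by blast
  let ?A = "adjacency_mat vs G"
  have "?A \<in> carrier_mat (length vs) (length vs)" by (simp add: adjacency_mat_def)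
  moreover have "length vs > 0" using vs assms(2) by auto
  ultimately have "spectral_radius ?A \<in> norm ` spectrum ?A"
    by (rule spectral_radius_mem_max(1))
  then obtain k where k: "eigenvalue ?A k" "graph_spectral_radius G = cmod k"
    using graph_spectral_radius_eq[OF vs(2,1)] by (auto simp: spectrum_def)
  then obtain f where f0: "\<exists>v\<in>pverts G. f v \<noteq> 0"
    and f: "\<And>v. v \<in> pverts G \<Longrightarrow> (\<Sum>u | u \<in> pverts G \<and> (v, u) \<in> parcs G. f u) = k * f v"
    unfolding eigenvalue_adjacency_mat_iff[OF vs(2)] vs(1) by blast
  obtain u where u: "u \<in> pverts G" "\<And>v. v \<in> pverts G \<Longrightarrow> cmod (f v) \<le> cmod (f u)"
  proof -
    have "finite ((\<lambda>v. cmod (f v)) ` pverts G)" "(\<lambda>v. cmod (f v)) ` pverts G \<noteq> {}"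
      using assms(2) by simp_all
    from Max_in[OF this] Max_ge[OF this(1)] that show ?thesis by fastforce
  qed
  have pos: "cmod (f u) > 0" using f0 u(2) by (metis norm_le_zero_iff not_le order_trans)
  have "cmod (f v) / cmod (f u) \<in> {0..1} \<and> graph_spectral_radius G * (cmod (f v) / cmod (f u))
      \<le> (\<Sum>w\<in>adj.nbrs (pverts G) v. cmod (f w) / cmod (f u))" if v: "v \<in> pverts G" for v
  proof
    show "cmod (f v) / cmod (f u) \<in> {0..1}" using u(2)[OF v] pos by simp
    have "graph_spectral_radius G * cmod (f v) = cmod (\<Sum>w\<in>adj.nbrs (pverts G) v. f w)"
      using f[OF v] k(2) by (simp add: adj.nbrs_def norm_mult)
    also have "\<dots> \<le> (\<Sum>w\<in>adj.nbrs (pverts G) v. cmod (f w))" by (rule norm_sum)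
    finally show "graph_spectral_radius G * (cmod (f v) / cmod (f u))
        \<le> (\<Sum>w\<in>adj.nbrs (pverts G) v. cmod (f w) / cmod (f u))"
      using pos by (simp add: divide_right_mono flip: sum_divide_distrib)
  qed
  moreover have "cmod (f u) / cmod (f u) = 1" using pos by simp
  ultimately show ?thesis
    using u(1) by (intro bexI[of _ u] exI[of _ "\<lambda>v. cmod (f v) / cmod (f u)"]) simp_all
qed

text \<open>
  Adjacency of distinct vertices depends only on their membership in \<open>T\<close>, so any bijection that
  takes \<open>T\<close> to the triangle is an isomorphism.
\<close>

lemma graph_iso_triangle_join:
  assumes "pair_graph G" and T: "T \<subseteq> pverts G" "card T = 3" and n: "card (pverts G - T) = n"
    and E: "\<And>v w. v \<in> pverts G \<Longrightarrow> w \<in> pverts G \<Longrightarrow>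
      (v, w) \<in> parcs G \<longleftrightarrow> v \<noteq> w \<and> (v \<in> T \<or> w \<in> T)"
  shows "graph_iso G (graph_join (complete_graph 3) (edgeless_graph n))"
proof -
  interpret pair_graph G by fact
  let ?V = "pverts G" and ?H = "graph_join (complete_graph 3) (edgeless_graph n)"
  have finT: "finite T" using T(1) pair_finite_verts finite_subset by blast
  obtain g h where g: "bij_betw g T {0..<3::nat}" and h: "bij_betw h (?V - T) {0..<n}"
    using ex_bij_betw_finite_nat[of T] ex_bij_betw_finite_nat[of "?V - T"] finT T(2) n by auto
  define f where "f v = (if v \<in> T then Inl (g v) else Inr (h v))" for v
  have inj: "inj_on f ?V"
    using g h by (auto simp: inj_on_def f_def bij_betw_def)
  have "f ` ?V = f ` T \<union> f ` (?V - T)" using T(1) by blast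
  also have "f ` T = Inl ` g ` T" unfolding image_image by (rule image_cong) (auto simp: f_def)
  also have "f ` (?V - T) = Inr ` h ` (?V - T)"
    unfolding image_image by (rule image_cong) (auto simp: f_def)
  also have "Inl ` g ` T \<union> Inr ` h ` (?V - T) = pverts ?H"
    using g h by (simp add: bij_betw_def graph_join_def complete_graph_def edgeless_graph_def
      Plus_def atLeast0LessThan)
  finally have verts: "pverts ?H = f ` ?V" by simp
  have parcs_H: "(p, q) \<in> parcs ?H \<longleftrightarrow>
      p \<in> pverts ?H \<and> q \<in> pverts ?H \<and> p \<noteq> q \<and> (isl p \<or> isl q)" for p q
    by (cases p; cases q)
       (auto simp: graph_join_def complete_graph_def edgeless_graph_def image_iff)
  have islf: "isl (f v) \<longleftrightarrow> v \<in> T" for v by (simp add: f_def)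
  have "parcs ?H = map_prod f f ` parcs G"
  proof (intro equalityI subsetI)
    fix e assume e: "e \<in> parcs ?H"
    obtain p q where pq: "e = (p, q)" by (cases e)
    with e have *: "p \<in> f ` ?V" "q \<in> f ` ?V" "p \<noteq> q" "isl p \<or> isl q"
      using parcs_H verts by auto
    then obtain v w where "v \<in> ?V" "w \<in> ?V" "p = f v" "q = f w" by blast
    with * have "(v, w) \<in> parcs G" using E islf by auto
    with \<open>p = f v\<close> \<open>q = f w\<close> pq show "e \<in> map_prod f f ` parcs G" by force
  next
    fix e assume "e \<in> map_prod f f ` parcs G"
    then obtain v w where vw: "(v, w) \<in> parcs G" "e = (f v, f w)" by auto
    have V: "v \<in> ?V" "w \<in> ?V" using vw(1) wellformed' by auto
    have "v \<noteq> w" "v \<in> T \<or> w \<in> T" using E[OF V] vw(1) by auto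
    moreover from this(1) have "f v \<noteq> f w" using inj V by (auto dest: inj_onD)
    ultimately show "e \<in> parcs ?H" using parcs_H V verts islf vw(2) by auto
  qed
  with inj verts show ?thesis unfolding graph_iso_iff[OF assms(1)] by blast
qed

theorem corollary1:
  fixes G :: "'a pair_pre_digraph" and m :: nat
  assumes "m \<ge> 38"
    and "pair_graph G"
    and "card (edges G) = m"
    and "\<And>u. \<not> isolated G u"
    and "graph_spectral_radius G \<ge> 1 + sqrt (real m - 2)"
    and "\<not> (3 dvd m \<and> graph_iso G (graph_join (complete_graph 3) (edgeless_graph ((m - 3) div 3))))"
  shows "\<forall>i\<in>{3..7}. contains_cycle G i"
proof (rule ccontr)
  assume "\<not> (\<forall>i\<in>{3..7}. contains_cycle G i)"
  then obtain i where i: "i \<in> {3..7}" "\<not> contains_cycle G i" by blast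
  interpret pair_graph G by fact
  let ?E = "\<lambda>v w. (v, w) \<in> parcs G" and ?V = "pverts G" and ?lam = "graph_spectral_radius G"
  interpret adjacency ?E by (rule adjacency_parcs) fact
  have missing: "length xs \<noteq> i" if "is_cycle ?V xs" for xs
    using contains_cycleI[OF assms(2) that] i by (cases "xs = []") auto
  have V: "?V \<noteq> {}"
  proof
    assume "?V = {}"
    then have "parcs G = {}" using wellformed' by fastforce
    then show False using assms(1,3) by (simp add: edges_def)
  qed
  have m: "2 * real m = (\<Sum>v\<in>?V. real (deg ?V v))"
    using sum_degrees[OF assms(2)] assms(3) by simp
  obtain u x where x: "u \<in> ?V" "x u = 1"
    "\<And>v. v \<in> ?V \<Longrightarrow> x v \<in> {0..1} \<and> ?lam * x v \<le> sum x (nbrs ?V v)"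
    using spectral_radius_subinvariant[OF assms(2) V] by auto
  \<comment> \<open>The bound 38 on the number of edges matters through \<open>m - 2 \<ge> 6\<^sup>2\<close>.\<close>
  have "sqrt (real m - 2) \<ge> sqrt 36" using assms(1) by (intro real_sqrt_le_mono) simp
  moreover have "sqrt 36 = (6::real)" by (rule real_sqrt_unique) auto
  ultimately have lam7: "?lam \<ge> 7" using assms(5) by linarith
  have "(sqrt (real m - 2))\<^sup>2 \<le> (?lam - 1)\<^sup>2"
    using assms(1,5) by (intro power_mono) auto
  then have lam: "real m - 3 \<le> ?lam\<^sup>2 - 2 * ?lam"
    using assms(1) by (simp add: power2_eq_square algebra_simps)
  interpret subinvariant ?E ?V x ?lam u
    using x lam7 wellformed' by unfold_locales auto
  have "\<exists>w. ?E v w" if "v \<in> ?V" for v using assms(4)[of v] that by (auto simp: isolated_def)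
  note struct = neighbourhood_is_book[OF m lam i(1) missing this]
  obtain a b where book: "is_book a b N" using struct(2) by blast
  note hubs = book_hubs[OF book]
  define T where "T = {u, a, b}"
  have VN: "?V = insert u N" using vertex_partition(8) struct(1) by simp
  have "u \<noteq> a" "u \<noteq> b" using hubs vertex_partition(5) by auto
  then have T: "T \<subseteq> ?V" "card T = 3" using hubs VN by (auto simp: T_def)
  have hub: "?E t y" if "t \<in> T" "y \<in> ?V" "y \<noteq> t" for t y
  proof -
    have Nu: "?E u z" "?E z u" if "z \<in> N" for z
      using that sym unfolding nbrs_def by blast+
    have ab: "?E a z" if "z \<in> N" "z \<noteq> a" for z
      using that hubs book_page(1)[OF book, of z] by (cases "z = b") auto
    have ba: "?E b z" if "z \<in> N" "z \<noteq> b" for z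
      using that hubs book_page(3)[OF book, of z] by (cases "z = a") auto
    consider "t = u" "y \<in> N" | "t = a" "y = u" | "t = a" "y \<in> N" | "t = b" "y = u" | "t = b" "y \<in> N"
      using \<open>t \<in> T\<close> \<open>y \<in> ?V\<close> \<open>y \<noteq> t\<close> VN unfolding T_def by blast
    then show ?thesis using Nu ab ba hubs(4,5) \<open>y \<noteq> t\<close> by cases simp_all
  qed
  have E: "?E v w \<longleftrightarrow> v \<noteq> w \<and> (v \<in> T \<or> w \<in> T)" if "v \<in> ?V" "w \<in> ?V" for v w
  proof (cases "v \<in> T \<or> w \<in> T")
    case True
    then show ?thesis using hub[of v w] hub[of w v] that sym irrefl by blast
  next
    case False
    then have "v \<in> N - {a, b}" "w \<in> N - {a, b}" using that VN by (auto simp: T_def)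
    then have "\<not> ?E v w" using book unfolding is_book_def by blast
    then show ?thesis using False by blast
  qed
  define n where "n = card (?V - T)"
  have cardV: "card ?V = n + 3"
    using T finV card_Diff_subset[of T ?V] card_mono[OF finV T(1)]
    by (auto simp: n_def finite_subset)
  have "deg ?V v = n + 2" if "v \<in> T" for v
  proof -
    have "nbrs ?V v = ?V - {v}" using E that T(1) by (auto simp: nbrs_def)
    then show ?thesis using cardV finV that T(1) by (auto simp: deg_def)
  qed
  moreover have "deg ?V v = 3" if "v \<in> ?V - T" for v
  proof -
    have "nbrs ?V v = T" using E that T(1) by (auto simp: nbrs_def)
    then show ?thesis using T(2) by (simp add: deg_def)
  qed
  moreover have "(\<Sum>v\<in>?V. real (deg ?V v)) = (\<Sum>v\<in>?V - T. real (deg ?V v)) + (\<Sum>v\<in>T. real (deg ?V v))"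
    by (rule sum.subset_diff[OF T(1) finV])
  \<comment> \<open>Counting degrees identifies the number of pages with the one in the exceptional graph.\<close>
  ultimately have "2 * real m = real n * 3 + 3 * (real n + 2)"
    using m T(2) by (simp add: n_def)
  then have "real m = real (3 * n + 3)" by simp
  then have "m = 3 * n + 3" by (simp only: of_nat_eq_iff)
  then have "3 dvd m" "(m - 3) div 3 = n" by auto
  moreover have "graph_iso G (graph_join (complete_graph 3) (edgeless_graph n))"
    using graph_iso_triangle_join[OF assms(2) T] n_def E by blast
  ultimately show False using assms(6) by simp
qed

end
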